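(* Let $n\ge2$. For every set $\Lambda_n=\{\lambda_0,\dots,\lambda_{n-1}\}$ of real numbers, the Hölder regularity of the generalized Daubechies type wavelet $\psi^{\Lambda_n}$ is equal to the Hölder regularity of the classical Daubechies wavelet $\psi_n$ derived from the classical $n$-th Daubechies refinable function $\varphi_n$.
   Context: Dimension $s=1$, dilation $M=2$. For a finitely supported real mask $\mathbf a=\{\mathrm a(\alpha)\}_{\alpha\in\mathbb Z}$ put $a_*(z)=\sum_\alpha\mathrm a(\alpha)z^\alpha$ and $(S_{\mathbf a}\boldsymbol c)(\alpha)=\sum_\beta\mathrm a(\alpha-2\beta)c(\beta)$. $\boldsymbol\delta$ is the sequence with value $1$ at $0$ and $0$ elsewhere. Limits of subdivision are understood as: $g=\lim_k S_{\mathbf a^{(k)}}\cdots S_{\mathbf a^{(1)}}\boldsymbol c$ if $g$ is continuous and $\sup_\alpha|g(2^{-k}\alpha)-(S_{\mathbf a^{(k)}}\cdots S_{\mathbf a^{(1)}}\boldsymbol c)(\alpha)|\to0$. Generalized Daubechies masks (construction of Dyn, Kounchev, Levin and Render). Numbers in $\Lambda_n$ may be repeated (counted with multiplicity). For each $k\ge1$ let $d^{(k)}(z)$ be the unique Laurent polynomial with exponents in $\{-(2n-1),\dots,2n-1\}$ such that $d^{(k)}(z)+d^{(k)}(-z)=2$ and $d^{(k)}$ vanishes at the points $-e^{\lambda_j2^{-k}}$ and $-e^{-\lambda_j2^{-k}}$, $j=0,\dots,n-1$ (with multiplicities). This is the symbol of the interpolatory scheme reproducing the exponential polynomials with spectrum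 $\Lambda_n\cup(-\Lambda_n)$; it is nonnegative on $|z|=1$. The mask $\mathbf a^{(k)}$, supported in $\{0,\dots,2n-1\}$, has symbol $a_*^{(k)}(z)=q^{(k)}(z)\prod_{j=0}^{n-1}(1+e^{\lambda_j2^{-k}}z)$, where $q^{(k)}$ is a real polynomial of degree $n-1$ with $q^{(k)}(1)>0$, chosen so that $\tfrac12a_*^{(k)}(z)a_*^{(k)}(1/z)=d^{(k)}(z)$, with all zeros of $q^{(k)}$ in $|z|\ge1$. The classical Daubechies mask $\mathbf m_n$ is the mask obtained by the same recipe with $\lambda_0=\dots=\lambda_{n-1}=0$ (it does not depend on $k$). The masks have the following properties: (i) $\mathbf a^{(k)}\to\mathbf m_n$ as $k\to\infty$; (ii) the symbols satisfy approximate sum rules of order $n$ with defects $\delta_k=\mathcal O(2^{-nk})$, that is, $\sum_k|a_*^{(k)}(1)-2|<\infty$ and $\delta_k:=\max_{0\le j\le n-1}2^{-kj}|D^ja_*^{(k)}(-1)|=\mathcal O(2^{-nk})$. Functions. $\varphi_n=\lim_kS_{\mathbf m_n}^k\boldsymbol\delta$ is the classical Daubechies refinable function, which is stable (there are $0<C_1\le C_2$ with $C_1\|\boldsymbol c\|_{\ell_\infty}\le\|\sum_\alpha c(\alpha)\varphi_n(\cdot-\alpha)\|_\infty\le C_2\|\boldsymbol c\|_{\ell_\infty}$), and $\psi_n=\sum_\alpha(-1)^\alpha\mathrm m_n(1-\alpha)\varphi_n(2\cdot-\alpha)$. With $\phi_k=\lim_{j\to\infty}S_{\mathbf a^{(k+j)}}\cdots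 S_{\mathbf a^{(k)}}\boldsymbol\delta$ (so that $\phi_k=\sum_\alpha\mathrm a^{(k)}(\alpha)\phi_{k+1}(2\cdot-\alpha)$), put $\phi^{\Lambda_n}=\phi_1$ and $\psi^{\Lambda_n}=\sum_\alpha(-1)^\alpha\mathrm a^{(1)}(1-\alpha)\phi_2(2\cdot-\alpha)$. A compactly supported wavelet has the same Hölder regularity as the corresponding refinable function, so the claim is equivalent to equality of the Hölder exponents of $\phi^{\Lambda_n}$ and $\varphi_n$. The Hölder regularity (exponent) of a function $g$ is $r+\zeta$, where $r$ is the largest integer with $g\in C^r(\mathbb R)$ and $\zeta$ is the supremum of $\nu\in[0,1]$ such that $|D^rg(x)-D^rg(y)|\le C|x-y|^\nu$ for all $x,y$ with some constant $C$. *)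

theory Defs
  imports "HOL-Analysis.Analysis" "HOL-Computational_Algebra.Computational_Algebra"
begin

text \<open>
  A mask, and likewise the coefficient sequence of a Laurent polynomial, is a finitely
  supported \<^typ>\<open>int \<Rightarrow> real\<close>.
\<close>

definition symbol :: "(int \<Rightarrow> real) \<Rightarrow> complex \<Rightarrow> complex" where
  "symbol a z = (\<Sum>\<alpha> | a \<alpha> \<noteq> 0. complex_of_real (a \<alpha>) * z powi \<alpha>)"

definition subdivision_op :: "(int \<Rightarrow> real) \<Rightarrow> (int \<Rightarrow> real) \<Rightarrow> int \<Rightarrow> real" where
  "subdivision_op a c \<alpha> = (\<Sum>\<beta> | a (\<alpha> - 2 * \<beta>) \<noteq> 0. a (\<alpha> - 2 * \<beta>) * c \<beta>)"

definition delta_seq :: "int \<Rightarrow> real" where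
  "delta_seq \<alpha> = (if \<alpha> = 0 then 1 else 0)"

text \<open>
  The masks are indexed from \<open>0\<close> here: \<open>subdivide A k c\<close> applies
  \<open>A 0\<close> first and \<open>A (k - 1)\<close> last.
\<close>

primrec subdivide :: "(nat \<Rightarrow> int \<Rightarrow> real) \<Rightarrow> nat \<Rightarrow> (int \<Rightarrow> real) \<Rightarrow> int \<Rightarrow> real" where
  "subdivide A 0 c = c"
| "subdivide A (Suc k) c = subdivision_op (A k) (subdivide A k c)"

text \<open>
  Uniform convergence to \<open>0\<close> over all of \<open>\<int>\<close> is the condition
  \<open>sup\<^sub>\<alpha> |g (2\<^sup>-\<^sup>k \<alpha>) - (S\<^sub>k \<dots> S\<^sub>1 c) \<alpha>| \<rightarrow> 0\<close>.
\<close>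

definition is_subdivision_limit ::
  "(nat \<Rightarrow> int \<Rightarrow> real) \<Rightarrow> (int \<Rightarrow> real) \<Rightarrow> (real \<Rightarrow> real) \<Rightarrow> bool" where
  "is_subdivision_limit A c g \<longleftrightarrow>
     continuous_on UNIV g \<and>
     uniform_limit UNIV (\<lambda>k \<alpha>. g (of_int \<alpha> / 2 ^ k) - subdivide A k c \<alpha>) (\<lambda>_. 0) sequentially"

text \<open>
  \<open>laurent_numerator N d\<close> is the polynomial \<open>z\<^sup>N d(z)\<close> for a Laurent polynomial \<open>d\<close> with
  exponents in \<open>{-N..N}\<close>; away from the origin it has the same zeros as \<open>d\<close>, with the same
  multiplicities.
\<close>

definition laurent_numerator :: "nat \<Rightarrow> (int \<Rightarrow> real) \<Rightarrow> real poly" where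
  "laurent_numerator N d = (\<Sum>i\<le>2 * N. monom (d (int i - int N)) i)"

text \<open>
  The symbol \<open>d\<close> of the interpolatory scheme with spectrum
  \<open>{\<mu>\<^sub>0, \<dots>, \<mu>\<^sub>n\<^sub>-\<^sub>1} \<union> {-\<mu>\<^sub>0, \<dots>, -\<mu>\<^sub>n\<^sub>-\<^sub>1}\<close>. The multiset inclusion counts the prescribed zeros
  with multiplicity; for instance every \<open>j\<close> with \<open>\<mu>\<^sub>j = 0\<close> contributes a double zero at \<open>-1\<close>.
\<close>

definition is_interpolatory_symbol :: "nat \<Rightarrow> (nat \<Rightarrow> real) \<Rightarrow> (int \<Rightarrow> real) \<Rightarrow> bool" where
  "is_interpolatory_symbol n \<mu> d \<longleftrightarrow>
     {\<alpha>. d \<alpha> \<noteq> 0} \<subseteq> {- (2 * int n - 1)..2 * int n - 1} \<and>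
     (\<forall>z. z \<noteq> 0 \<longrightarrow> symbol d z + symbol d (- z) = 2) \<and>
     {#- exp (\<mu> j). j \<in># mset_set {..<n}#} + {#- exp (- \<mu> j). j \<in># mset_set {..<n}#}
       \<subseteq># proots (laurent_numerator (2 * n - 1) d)"

definition is_daubechies_mask :: "nat \<Rightarrow> (nat \<Rightarrow> real) \<Rightarrow> (int \<Rightarrow> real) \<Rightarrow> bool" where
  "is_daubechies_mask n \<mu> a \<longleftrightarrow>
     {\<alpha>. a \<alpha> \<noteq> 0} \<subseteq> {0..2 * int n - 1} \<and>
     (\<exists>d (q :: real poly).
        is_interpolatory_symbol n \<mu> d \<and>
        degree q = n - 1 \<and> poly q 1 > 0 \<and>
        (\<forall>z::complex. poly (map_poly complex_of_real q) z = 0 \<longrightarrow> cmod z \<ge> 1) \<and>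
        (\<forall>z. symbol a z =
           poly (map_poly complex_of_real q) z * (\<Prod>j<n. 1 + complex_of_real (exp (\<mu> j)) * z)) \<and>
        (\<forall>z. z \<noteq> 0 \<longrightarrow> symbol a z * symbol a (1 / z) / 2 = symbol d z))"

text \<open>
  The mask of level \<open>k\<close> of the generalized Daubechies scheme with frequencies
  \<open>\<Lambda> 0, \<dots>, \<Lambda> (n - 1)\<close>; only these values of \<open>\<Lambda>\<close> matter, and they may be repeated.
\<close>

definition is_generalized_daubechies_mask ::
  "nat \<Rightarrow> (nat \<Rightarrow> real) \<Rightarrow> nat \<Rightarrow> (int \<Rightarrow> real) \<Rightarrow> bool" where
  "is_generalized_daubechies_mask n \<Lambda> k a \<longleftrightarrow> is_daubechies_mask n (\<lambda>j. \<Lambda> j / 2 ^ k) a"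

definition is_classical_daubechies_mask :: "nat \<Rightarrow> (int \<Rightarrow> real) \<Rightarrow> bool" where
  "is_classical_daubechies_mask n m \<longleftrightarrow> is_daubechies_mask n (\<lambda>_. 0) m"

definition wavelet :: "(int \<Rightarrow> real) \<Rightarrow> (real \<Rightarrow> real) \<Rightarrow> real \<Rightarrow> real" where
  "wavelet a \<phi> x =
     (\<Sum>\<alpha> | a (1 - \<alpha>) \<noteq> 0. (- 1) powi \<alpha> * a (1 - \<alpha>) * \<phi> (2 * x - of_int \<alpha>))"

definition C_on_reals :: "nat \<Rightarrow> (real \<Rightarrow> real) \<Rightarrow> bool" where
  "C_on_reals r g \<longleftrightarrow>
     (\<forall>i<r. \<forall>x. (deriv ^^ i) g differentiable at x) \<and> continuous_on UNIV ((deriv ^^ r) g)"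

text \<open>
  Meaningful for bounded continuous functions that are not infinitely differentiable and whose
  highest continuous derivative is bounded, which covers the compactly supported functions
  considered here. For \<open>\<nu> = 0\<close> the convention \<^prop>\<open>(0::real) powr 0 = 0\<close> is harmless,
  since the left-hand side vanishes for \<open>x = y\<close>.
\<close>

definition hoelder_regularity :: "(real \<Rightarrow> real) \<Rightarrow> real" where
  "hoelder_regularity g =
     (let r = (GREATEST r. C_on_reals r g)
      in real r + Sup {\<nu>. 0 \<le> \<nu> \<and> \<nu> \<le> 1 \<and>
           (\<exists>C. \<forall>x y. \<bar>(deriv ^^ r) g x - (deriv ^^ r) g y\<bar> \<le> C * \<bar>x - y\<bar> powr \<nu>)})"

end

(*
  With generating functions on the grid 2^-J Z, the J-fold subdivision C_J for the generalized masks
  and M_J for the classical mask satisfy C_J = R_J M_J, where R_J is a power series: the factors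
  1 + exp(lambda 2^-k) z telescope to ratios of the form (1 - e z) / (1 - e' z), and what remains is the
  product of the dilated ratios q^(k) / q of the spectral factors. Since q has no zeros in |z| <= 1, the
  series 1/q is absolutely summable, and q^(k) - q = O(2^-k) then shows that the coefficients of R_J
  belonging to shifts in a bounded interval are absolutely summable, uniformly in J. So one wavelet is
  a limit of uniformly bounded combinations of right translates of the other; derivatives and Hoelder
  estimates pass to such limits, and exchanging the two mask sequences gives the converse.
*)

theory Submission
  imports Defs
begin

text \<open>The two mask families are compared on three scales. Ratios in y^(2^J) are combinations
  of integer shifts, of which a bounded interval sees boundedly many. Ratios in y itself need not
  have summable coefficients, since e' may be 1 or more; but the nodes e and e' differ by O(2^-J),
  which pays for the O(2^J) coefficients that are seen. The quotients q^(k) / q are seen over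
  windows that grow with k and need a bound on the whole series, which a zero of q on the unit
  circle would destroy.

  The rate O(2^-k) rests on the linearization of q -> q(z) q(1/z) at the classical q being
  injective: the roots of q lie outside the closed disc and those of its reciprocal inside.
  Compactness of the bounded spectral factors turns this into the rate.

  Both wavelets vanish outside the interval from 1 - n to n. The common left end makes all shifts go
  to the right, and the nonzero top mask coefficients make the quotients power series; the right end
  turns estimates on a bounded interval into global ones.\<close>

section \<open>Derivatives of pointwise limits and Hoelder regularity\<close>

text \<open>Equicontinuity of the derivatives at the single point \<open>x\<close>, uniform in
  \<open>J\<close>, is enough: by the mean value theorem the difference quotients at
  \<open>x\<close> stay within e of \<open>G' J x\<close> for all \<open>J\<close> at once. The
  quotients converge at a fixed nearby point, so the derivatives at \<open>x\<close> are Cauchy, and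
  the same estimate in the limit gives differentiability.\<close>

lemma pointwise_limit_has_derivative:
  fixes G G' :: "nat \<Rightarrow> real \<Rightarrow> real" and g :: "real \<Rightarrow> real"
  assumes "open S" "x \<in> S"
    and deriv: "\<And>J y. y \<in> S \<Longrightarrow> (G J has_real_derivative G' J y) (at y)"
    and lim: "\<And>y. y \<in> S \<Longrightarrow> (\<lambda>J. G J y) \<longlonglongrightarrow> g y"
    and equi: "\<And>e. e > 0 \<Longrightarrow> \<exists>d>0. \<forall>J y. \<bar>y - x\<bar> < d \<longrightarrow> \<bar>G' J y - G' J x\<bar> \<le> e"
  shows "\<exists>L. (\<lambda>J. G' J x) \<longlonglongrightarrow> L \<and> (g has_real_derivative L) (at x)"
proof -
  have mvt: "\<exists>d>0. \<forall>y. \<bar>y - x\<bar> < d \<longrightarrow> y \<in> S \<and>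
      (\<forall>J. \<bar>(G J y - G J x) - (y - x) * G' J x\<bar> \<le> e * \<bar>y - x\<bar>)" if "e > 0" for e
  proof -
    obtain d1 where d1: "d1 > 0" "\<And>J y. \<bar>y - x\<bar> < d1 \<Longrightarrow> \<bar>G' J y - G' J x\<bar> \<le> e"
      using equi \<open>e > 0\<close> by metis
    obtain d2 where d2: "d2 > 0" "ball x d2 \<subseteq> S"
      using \<open>open S\<close> \<open>x \<in> S\<close> open_contains_ball by blast
    define d where "d = min d1 d2"
    have S: "y \<in> S" if "\<bar>y - x\<bar> < d" for y
      using that d2 by (auto simp: d_def dist_real_def)
    have "\<bar>(G J y - G J x) - (y - x) * G' J x\<bar> \<le> e * \<bar>y - x\<bar>" if "\<bar>y - x\<bar> < d" for y J
    proof -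
      have "norm (G J y - G J x - (y - x) * G' J x) \<le> norm (y - x) * e"
      proof (rule differentiable_bound_linearization[where S = "ball x d" and f' = "\<lambda>z t. t * G' J z"])
        show "x + t *\<^sub>R (y - x) \<in> ball x d" if "t \<in> {0..1}" for t
        proof -
          have "\<bar>t * (y - x)\<bar> \<le> 1 * \<bar>y - x\<bar>"
            unfolding abs_mult using that by (intro mult_right_mono) auto
          then show ?thesis using \<open>\<bar>y - x\<bar> < d\<close> by (simp add: dist_real_def)
        qed
        show "((G J) has_derivative (\<lambda>t. t * G' J z)) (at z within ball x d)" if "z \<in> ball x d" for z
          using deriv[of z J] S[of z] that
          by (auto simp: has_field_derivative_def dist_real_def mult.commute[of _ "G' J z"] abs_minus_commute
              intro!: has_derivative_at_withinI)
        show "onorm ((\<lambda>t. t * G' J z) - (\<lambda>t. t * G' J x)) \<le> e" if "z \<in> ball x d" for z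
        proof (rule onorm_bound)
          have "\<bar>z - x\<bar> < d1" using that by (simp add: d_def dist_real_def abs_minus_commute)
          then have "\<bar>G' J z - G' J x\<bar> \<le> e" by (rule d1(2))
          then show "norm (((\<lambda>t. t * G' J z) - (\<lambda>t. t * G' J x)) i) \<le> e * norm i" for i
            by (simp add: right_diff_distrib[symmetric] abs_mult mult.commute[of e] mult_left_mono)
        qed (use \<open>e > 0\<close> in simp)
        show "x \<in> ball x d" using d1 d2 by (simp add: d_def)
      qed
      then show ?thesis by (simp add: mult.commute)
    qed
    with S d1(1) d2(1) show ?thesis by (intro exI[of _ d]) (auto simp: d_def)
  qed
  have "Cauchy (\<lambda>J. G' J x)"
  proof (rule metric_CauchyI)
    fix e :: real assume "e > 0"
    then obtain d where d: "d > 0" "\<And>y J. \<bar>y - x\<bar> < d \<Longrightarrow> y \<in> S \<and>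
        \<bar>(G J y - G J x) - (y - x) * G' J x\<bar> \<le> e / 3 * \<bar>y - x\<bar>"
      using mvt[of "e / 3"] by auto
    define y where "y = x + d / 2"
    have y: "\<bar>y - x\<bar> < d" "y - x = d / 2" using d by (auto simp: y_def)
    have "(\<lambda>J. (G J y - G J x) / (y - x)) \<longlonglongrightarrow> (g y - g x) / (y - x)"
      using y d by (intro tendsto_intros lim \<open>x \<in> S\<close>) auto
    then have "Cauchy (\<lambda>J. (G J y - G J x) / (y - x))" by (rule LIMSEQ_imp_Cauchy)
    then obtain N where N: "\<And>I J. I \<ge> N \<Longrightarrow> J \<ge> N \<Longrightarrow>
        \<bar>(G I y - G I x) / (y - x) - (G J y - G J x) / (y - x)\<bar> < e / 3"
      using \<open>e > 0\<close> unfolding Cauchy_def dist_real_def by (meson divide_pos_pos zero_less_numeral)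
    have q: "\<bar>(G J y - G J x) / (y - x) - G' J x\<bar> \<le> e / 3" for J
    proof -
      have "\<bar>(G J y - G J x) - (y - x) * G' J x\<bar> \<le> e / 3 * (d / 2)"
        using d(2)[OF y(1), of J] unfolding y(2) using d(1) by simp
      moreover have "(G J y - G J x) / (y - x) - G' J x = ((G J y - G J x) - (y - x) * G' J x) / (d / 2)"
        using d(1) y(2) by (simp add: field_simps)
      moreover have "\<bar>z / (d / 2)\<bar> \<le> e / 3" if "\<bar>z\<bar> \<le> e / 3 * (d / 2)" for z
        using that d(1) by (simp add: abs_divide divide_le_eq)
      ultimately show ?thesis by metis
    qed
    show "\<exists>M. \<forall>m\<ge>M. \<forall>n\<ge>M. dist (G' m x) (G' n x) < e"
    proof (intro exI allI impI)
      fix I J assume "I \<ge> N" "J \<ge> N"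
      then show "dist (G' I x) (G' J x) < e"
        using N[of I J] q[of I] q[of J] unfolding dist_real_def by linarith
    qed
  qed
  then obtain L where L: "(\<lambda>J. G' J x) \<longlonglongrightarrow> L"
    using Cauchy_convergent convergent_def by blast
  have "(g has_derivative (\<lambda>t. L * t)) (at x)"
    unfolding has_derivative_at_alt
  proof (intro conjI allI impI bounded_linear_mult_right)
    fix e :: real assume "e > 0"
    then obtain d where d: "d > 0" "\<And>y J. \<bar>y - x\<bar> < d \<Longrightarrow> y \<in> S \<and>
        \<bar>(G J y - G J x) - (y - x) * G' J x\<bar> \<le> e * \<bar>y - x\<bar>"
      using mvt[of e] by auto
    have "\<bar>(g y - g x) - (y - x) * L\<bar> \<le> e * \<bar>y - x\<bar>" if "\<bar>y - x\<bar> < d" for y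
    proof (rule LIMSEQ_le_const2)
      show "(\<lambda>J. \<bar>(G J y - G J x) - (y - x) * G' J x\<bar>) \<longlonglongrightarrow> \<bar>(g y - g x) - (y - x) * L\<bar>"
        using d(2)[OF that] by (intro tendsto_intros lim L \<open>x \<in> S\<close>) auto
    qed (use d(2)[OF that] in auto)
    then show "\<exists>d>0. \<forall>y. norm (y - x) < d \<longrightarrow> norm (g y - g x - L * (y - x)) \<le> e * norm (y - x)"
      using d(1) by (auto simp: mult.commute)
  qed
  then show ?thesis using L unfolding has_field_derivative_def by blast
qed

lemma uniform_modulus_of_compact_support:
  fixes f :: "real \<Rightarrow> real"
  assumes "continuous_on UNIV f" and supp: "\<And>x. x \<notin> {l..r} \<Longrightarrow> f x = 0" and "e > 0"
  shows "\<exists>d>0. \<forall>x y. \<bar>x - y\<bar> < d \<longrightarrow> \<bar>f x - f y\<bar> < e"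
proof -
  \<comment> \<open>The margin of 1 disposes of the remaining pairs: if two points are closer than 1
    and one is outside the enlarged interval, both are outside \<open>{l..r}\<close>.\<close>
  have "uniformly_continuous_on {l - 1..r + 1} f"
    using assms(1) by (intro compact_uniformly_continuous) (auto intro: continuous_on_subset)
  then obtain d where d: "d > 0" "\<And>x y. x \<in> {l - 1..r + 1} \<Longrightarrow> y \<in> {l - 1..r + 1} \<Longrightarrow> \<bar>y - x\<bar> < d \<Longrightarrow> \<bar>f y - f x\<bar> < e"
    unfolding uniformly_continuous_on_def dist_real_def using \<open>e > 0\<close> by metis
  have "\<bar>f x - f y\<bar> < e" if "\<bar>x - y\<bar> < min d 1" for x y
  proof (cases "x \<in> {l - 1..r + 1} \<and> y \<in> {l - 1..r + 1}")
    case True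
    then show ?thesis using d(2)[of y x] that by auto
  next
    case False
    then have "x \<notin> {l..r}" "y \<notin> {l..r}" using that by auto
    then show ?thesis using supp \<open>e > 0\<close> by simp
  qed
  then show ?thesis using d(1) by (intro exI[of _ "min d 1"]) auto
qed

lemma higher_deriv_vanishes:
  fixes f :: "real \<Rightarrow> real"
  assumes "\<And>x. x \<notin> {l..r} \<Longrightarrow> f x = 0" "x \<notin> {l..r}"
  shows "(deriv ^^ k) f x = 0"
proof -
  have "open (- {l..r})" by (intro open_Compl) auto
  then have "\<forall>\<^sub>F y in nhds x. y \<in> - {l..r}"
    using assms(2) by (intro eventually_nhds_in_open) auto
  then have "\<forall>\<^sub>F y in nhds x. f y = (\<lambda>_. 0) y" by (rule eventually_mono) (use assms(1) in auto)
  then have "(deriv ^^ k) f x = (deriv ^^ k) (\<lambda>_. 0) x"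
    by (rule higher_deriv_cong_ev) simp
  also have "\<dots> = 0"
  proof (induction k arbitrary: x)
    case (Suc k)
    then have "(deriv ^^ k) (\<lambda>_. 0::real) = (\<lambda>_. 0)" by (rule ext)
    then show ?case by simp
  qed simp
  finally show ?thesis .
qed

lemma C_on_reals_Suc_iff:
  "C_on_reals (Suc r) g \<longleftrightarrow> C_on_reals r g \<and>
     (\<forall>x. (deriv ^^ r) g differentiable at x) \<and> continuous_on UNIV ((deriv ^^ Suc r) g)"
proof -
  have "continuous_on UNIV ((deriv ^^ r) g)" if "\<forall>x. (deriv ^^ r) g differentiable at x"
    using that by (intro continuous_at_imp_continuous_on ballI differentiable_imp_continuous_within) auto
  then show ?thesis unfolding C_on_reals_def less_Suc_eq by blast
qed

lemma C_on_reals_mono: "C_on_reals r g \<Longrightarrow> s \<le> r \<Longrightarrow> C_on_reals s g"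
  by (induction r) (auto simp: le_Suc_eq C_on_reals_Suc_iff)

lemma hoelder_regularity_eqI:
  assumes C: "\<And>r. C_on_reals r f \<longleftrightarrow> C_on_reals r g" and "continuous_on UNIV f"
    and holder: "\<And>r \<nu>. C_on_reals r f \<Longrightarrow> C_on_reals r g \<Longrightarrow> 0 \<le> \<nu> \<Longrightarrow>
      (\<exists>c. \<forall>x y. \<bar>(deriv ^^ r) f x - (deriv ^^ r) f y\<bar> \<le> c * \<bar>x - y\<bar> powr \<nu>) \<longleftrightarrow>
      (\<exists>c. \<forall>x y. \<bar>(deriv ^^ r) g x - (deriv ^^ r) g y\<bar> \<le> c * \<bar>x - y\<bar> powr \<nu>)"
  shows "hoelder_regularity f = hoelder_regularity g"
proof -
  define r where "r = (GREATEST r. C_on_reals r f)"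
  have r: "C_on_reals r f"
  proof (cases "\<exists>b. \<forall>s. C_on_reals s f \<longrightarrow> s \<le> b")
    case True
    moreover have "C_on_reals 0 f" using assms(2) by (simp add: C_on_reals_def)
    ultimately show ?thesis unfolding r_def by (metis GreatestI_nat)
  next
    \<comment> \<open>For a smooth \<open>f\<close> the \<open>GREATEST\<close> is an unspecified
      number, but then \<open>C_on_reals\<close> holds at every order, this one included.\<close>
    case False
    then show ?thesis by (meson C_on_reals_mono nat_le_linear)
  qed
  have r': "(GREATEST r. C_on_reals r g) = r" by (simp add: r_def C)
  have "{\<nu>. 0 \<le> \<nu> \<and> \<nu> \<le> 1 \<and> (\<exists>c. \<forall>x y. \<bar>(deriv ^^ r) f x - (deriv ^^ r) f y\<bar> \<le> c * \<bar>x - y\<bar> powr \<nu>)}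
      = {\<nu>. 0 \<le> \<nu> \<and> \<nu> \<le> 1 \<and> (\<exists>c. \<forall>x y. \<bar>(deriv ^^ r) g x - (deriv ^^ r) g y\<bar> \<le> c * \<bar>x - y\<bar> powr \<nu>)}"
    using holder[OF r] C r by (intro Collect_cong conj_cong) auto
  then show ?thesis unfolding hoelder_regularity_def r' r_def[symmetric] Let_def by simp
qed

section \<open>Transfer of regularity through convolution\<close>

text \<open>The transfer principle used in both directions. \<open>U\<close> and \<open>W\<close>
  generate approximate samples at mesh \<open>H / 2 ^ J\<close>, indexed by naturals because both
  functions vanish left of \<open>l\<close>. \<open>R_bound\<close> controls the shifts shorter than
  \<open>H * X\<close>, the ones that matter on a bounded interval.\<close>

locale grid_transfer =
  fixes u w :: "real \<Rightarrow> real" and U W R :: "nat \<Rightarrow> real fps" and l r H :: real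
  assumes H: "H > 0"
    and u_cont: "continuous_on UNIV u" and w_cont: "continuous_on UNIV w"
    and u_supp: "\<And>x. x \<notin> {l..r} \<Longrightarrow> u x = 0" and w_supp: "\<And>x. x \<notin> {l..r} \<Longrightarrow> w x = 0"
    and u_grid: "\<And>e. e > 0 \<Longrightarrow> \<forall>\<^sub>F J in sequentially. \<forall>\<alpha>. \<bar>u (l + H * real \<alpha> / 2 ^ J) - U J $ \<alpha>\<bar> < e"
    and w_grid: "\<And>e. e > 0 \<Longrightarrow> \<forall>\<^sub>F J in sequentially. \<forall>\<alpha>. \<bar>w (l + H * real \<alpha> / 2 ^ J) - W J $ \<alpha>\<bar> < e"
    and factor: "\<And>J. W J = R J * U J"
    and R_bound: "\<And>X. \<exists>K. \<forall>J. (\<Sum>\<beta><X * 2 ^ J. \<bar>R J $ \<beta>\<bar>) \<le> K"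
begin

text \<open>Left of \<open>l + H * real X\<close> the cut-off at \<open>X * 2 ^ J\<close> is
  invisible: the omitted translates are evaluated left of \<open>l\<close>, where \<open>u\<close>
  and its derivatives vanish.\<close>

definition conv :: "nat \<Rightarrow> nat \<Rightarrow> (real \<Rightarrow> real) \<Rightarrow> real \<Rightarrow> real" where
  "conv X J f x = (\<Sum>\<beta><X * 2 ^ J. R J $ \<beta> * f (x - H * real \<beta> / 2 ^ J))"

lemma conv_bound:
  obtains K where "K > 0" "\<And>J. (\<Sum>\<beta><X * 2 ^ J. \<bar>R J $ \<beta>\<bar>) \<le> K"
proof -
  obtain K where K: "\<And>J. (\<Sum>\<beta><X * 2 ^ J. \<bar>R J $ \<beta>\<bar>) \<le> K" using R_bound by blast
  show thesis by (rule that[of "max K 1"]) (use K le_max_iff_disj in \<open>auto\<close>)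
qed

lemma conv_diff_le:
  assumes K: "\<And>J. (\<Sum>\<beta><X * 2 ^ J. \<bar>R J $ \<beta>\<bar>) \<le> K" and "c \<ge> 0"
    and c: "\<And>t. \<bar>f (x - t) - f (y - t)\<bar> \<le> c"
  shows "\<bar>conv X J f x - conv X J f y\<bar> \<le> K * c"
proof -
  have "\<bar>conv X J f x - conv X J f y\<bar> =
      \<bar>\<Sum>\<beta><X * 2 ^ J. R J $ \<beta> * (f (x - H * real \<beta> / 2 ^ J) - f (y - H * real \<beta> / 2 ^ J))\<bar>"
    by (simp add: conv_def sum_subtractf right_diff_distrib)
  also have "\<dots> \<le> (\<Sum>\<beta><X * 2 ^ J. \<bar>R J $ \<beta>\<bar> * c)"
    by (rule order_trans[OF sum_abs]) (auto intro!: sum_mono mult_left_mono c simp: abs_mult)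
  also have "\<dots> \<le> K * c"
    using K[of J] \<open>c \<ge> 0\<close> by (simp add: sum_distrib_right[symmetric] mult_right_mono)
  finally show ?thesis .
qed

text \<open>A grid point of level \<open>I\<close> belongs to every finer grid. There
  \<open>conv\<close> is the Cauchy product \<open>R J * U J\<close> with \<open>U J\<close>
  replaced by true samples of \<open>u\<close>, so it misses the coefficient of \<open>W J\<close>
  by at most \<open>K\<close> times the sampling error.\<close>

lemma conv_grid_limit:
  assumes "\<alpha> < X * 2 ^ I"
  shows "(\<lambda>J. conv X J u (l + H * real \<alpha> / 2 ^ I)) \<longlonglongrightarrow> w (l + H * real \<alpha> / 2 ^ I)"
proof (rule LIMSEQ_I)
  fix e :: real assume "e > 0"
  obtain K where K: "K > 0" "\<And>J. (\<Sum>\<beta><X * 2 ^ J. \<bar>R J $ \<beta>\<bar>) \<le> K" using conv_bound by blast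
  define x where "x = l + H * real \<alpha> / 2 ^ I"
  have ev: "\<forall>\<^sub>F J in sequentially. I \<le> J \<and>
      (\<forall>\<alpha>. \<bar>u (l + H * real \<alpha> / 2 ^ J) - U J $ \<alpha>\<bar> < e / (2 * K)) \<and>
      (\<forall>\<alpha>. \<bar>w (l + H * real \<alpha> / 2 ^ J) - W J $ \<alpha>\<bar> < e / 2)"
    using \<open>e > 0\<close> K(1) by (intro eventually_conj eventually_ge_at_top u_grid w_grid) auto
  have "\<forall>\<^sub>F J in sequentially. \<bar>conv X J u x - w x\<bar> < e"
    using ev
  proof (rule eventually_mono, elim conjE)
    fix J assume "I \<le> J"
      and u: "\<forall>\<alpha>. \<bar>u (l + H * real \<alpha> / 2 ^ J) - U J $ \<alpha>\<bar> < e / (2 * K)"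
      and w: "\<forall>\<alpha>. \<bar>w (l + H * real \<alpha> / 2 ^ J) - W J $ \<alpha>\<bar> < e / 2"
    define m where "m = \<alpha> * 2 ^ (J - I)"
    have "(2::nat) ^ J = 2 ^ I * 2 ^ (J - I)" using \<open>I \<le> J\<close> by (simp flip: power_add)
    then have m: "m < X * 2 ^ J" using assms by (simp add: m_def mult.assoc[symmetric])
    have "(2::real) ^ J = 2 ^ I * 2 ^ (J - I)" using \<open>I \<le> J\<close> by (simp flip: power_add)
    then have x: "x = l + H * real m / 2 ^ J" by (simp add: x_def m_def)
    have pt: "x - H * real \<beta> / 2 ^ J = l + H * real (m - \<beta>) / 2 ^ J" if "\<beta> \<le> m" for \<beta>
      using that by (simp add: x of_nat_diff diff_divide_distrib right_diff_distrib)
    have "u (x - H * real \<beta> / 2 ^ J) = 0" if "\<not> \<beta> \<le> m" for \<beta>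
    proof (rule u_supp)
      have "H * real m / 2 ^ J < H * real \<beta> / 2 ^ J"
        using that H by (simp add: divide_strict_right_mono)
      then show "x - H * real \<beta> / 2 ^ J \<notin> {l..r}" by (simp add: x)
    qed
    then have "conv X J u x = (\<Sum>\<beta>\<le>m. R J $ \<beta> * u (l + H * real (m - \<beta>) / 2 ^ J))"
      unfolding conv_def using m by (intro sum.mono_neutral_cong_right) (auto simp: pt)
    moreover have "W J $ m = (\<Sum>\<beta>\<le>m. R J $ \<beta> * U J $ (m - \<beta>))"
      by (simp add: factor fps_mult_nth atLeast0AtMost)
    ultimately have "\<bar>conv X J u x - W J $ m\<bar> =
        \<bar>\<Sum>\<beta>\<le>m. R J $ \<beta> * (u (l + H * real (m - \<beta>) / 2 ^ J) - U J $ (m - \<beta>))\<bar>"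
      by (simp add: sum_subtractf right_diff_distrib)
    also have "\<dots> \<le> (\<Sum>\<beta>\<le>m. \<bar>R J $ \<beta>\<bar> * (e / (2 * K)))"
      by (rule order_trans[OF sum_abs], rule sum_mono, simp only: abs_mult)
        (intro mult_left_mono less_imp_le u[rule_format] abs_ge_zero)
    also have "\<dots> \<le> (\<Sum>\<beta><X * 2 ^ J. \<bar>R J $ \<beta>\<bar> * (e / (2 * K)))"
      using m \<open>e > 0\<close> K(1) by (intro sum_mono2) auto
    also have "\<dots> \<le> K * (e / (2 * K))"
      using K(2)[of J] \<open>e > 0\<close> K(1) by (simp only: sum_distrib_right[symmetric]) (intro mult_right_mono, auto)
    also have "\<dots> = e / 2" using K(1) by simp
    finally have "\<bar>conv X J u x - W J $ m\<bar> \<le> e / 2" .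
    moreover have "\<bar>w x - W J $ m\<bar> < e / 2" using w by (simp add: x)
    ultimately show "\<bar>conv X J u x - w x\<bar> < e" by linarith
  qed
  then show "\<exists>no. \<forall>n\<ge>no. norm (conv X n u (l + H * real \<alpha> / 2 ^ I) - w (l + H * real \<alpha> / 2 ^ I)) < e"
    by (simp add: x_def eventually_sequentially)
qed

text \<open>Equicontinuity extends the limit from the dyadic points: \<open>x\<close> is compared
  with the grid point \<open>y\<close> just left of it, at a level fine enough for the moduli of
  both functions.\<close>

lemma conv_limit:
  assumes "x < l + H * real X"
  shows "(\<lambda>J. conv X J u x) \<longlonglongrightarrow> w x"
proof (cases "x < l")
  case True
  have "u (x - H * real \<beta> / 2 ^ J) = 0" for \<beta> J
  proof (rule u_supp)
    have "H * real \<beta> / 2 ^ J \<ge> 0" using H by simp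
    then show "x - H * real \<beta> / 2 ^ J \<notin> {l..r}" using True unfolding atLeastAtMost_iff by linarith
  qed
  then show ?thesis using True w_supp by (simp add: conv_def)
next
  case False
  show ?thesis
  proof (rule LIMSEQ_I)
    fix e :: real assume "e > 0"
    obtain K where K: "K > 0" "\<And>J. (\<Sum>\<beta><X * 2 ^ J. \<bar>R J $ \<beta>\<bar>) \<le> K" using conv_bound by blast
    obtain d where d: "d > 0" "\<And>s t. \<bar>s - t\<bar> < d \<Longrightarrow> \<bar>u s - u t\<bar> < e / (3 * K)"
      using uniform_modulus_of_compact_support[where l = l and r = r, OF u_cont u_supp, of "e / (3 * K)"] \<open>e > 0\<close> K(1) by auto
    obtain d' where d': "d' > 0" "\<And>s t. \<bar>s - t\<bar> < d' \<Longrightarrow> \<bar>w s - w t\<bar> < e / 3"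
      using uniform_modulus_of_compact_support[where l = l and r = r, OF w_cont w_supp, of "e / 3"] \<open>e > 0\<close> by auto
    obtain I where I: "H / min d d' < 2 ^ I" using real_arch_pow[of 2] by auto
    then have "H < 2 ^ I * min d d'" using d(1) d'(1) by (subst (asm) pos_divide_less_eq) auto
    then have I': "H / 2 ^ I < min d d'"
      by (subst pos_divide_less_eq) (simp_all add: mult.commute del: min_less_iff_conj)
    define \<alpha> where "\<alpha> = nat \<lfloor>(x - l) * 2 ^ I / H\<rfloor>"
    define y where "y = l + H * real \<alpha> / 2 ^ I"
    have nonneg: "(x - l) * 2 ^ I / H \<ge> 0" using False H by simp
    then have al: "real \<alpha> \<le> (x - l) * 2 ^ I / H" "(x - l) * 2 ^ I / H < real \<alpha> + 1"
      by (auto simp: \<alpha>_def)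
    have "y \<le> x" using al(1) H by (simp add: y_def field_simps)
    moreover have "x < y + H / 2 ^ I" using al(2) H by (simp add: y_def field_simps)
    ultimately have xy: "\<bar>x - y\<bar> < d" "\<bar>x - y\<bar> < d'" using I' by auto
    have "real \<alpha> < real (X * 2 ^ I)"
    proof -
      have "(x - l) * 2 ^ I / H < real X * 2 ^ I"
      proof -
        have "(x - l) * 2 ^ I < H * real X * 2 ^ I"
          using assms by (intro mult_strict_right_mono) auto
        then show ?thesis using H by (subst pos_divide_less_eq) (auto simp: mult_ac)
      qed
      then show ?thesis using al(1) by simp
    qed
    then have "\<alpha> < X * 2 ^ I" by (simp only: of_nat_less_iff)
    then have "(\<lambda>J. conv X J u y) \<longlonglongrightarrow> w y" unfolding y_def by (rule conv_grid_limit)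
    then obtain N where N: "\<And>J. J \<ge> N \<Longrightarrow> \<bar>conv X J u y - w y\<bar> < e / 3"
      using \<open>e > 0\<close> LIMSEQ_D[of "\<lambda>J. conv X J u y" "w y" "e / 3"] by auto
    have "\<bar>conv X J u x - w x\<bar> < e" if "J \<ge> N" for J
    proof -
      have "\<bar>conv X J u x - conv X J u y\<bar> \<le> K * (e / (3 * K))"
        using K(1) \<open>e > 0\<close> xy by (intro conv_diff_le K less_imp_le[OF d(2)]) auto
      also have "\<dots> = e / 3" using K(1) by simp
      finally show ?thesis using N[OF that] d'(2)[OF xy(2)] by linarith
    qed
    then show "\<exists>no. \<forall>n\<ge>no. norm (conv X n u x - w x) < e" by auto
  qed
qed

lemma conv_has_derivative:
  assumes "\<And>x. (f has_real_derivative f' x) (at x)"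
  shows "(conv X J f has_real_derivative conv X J f' x) (at x)"
  unfolding conv_def
  by (auto intro!: derivative_eq_intros DERIV_chain'[of _ _ _ _ f] assms simp: mult.commute)

lemma conv_equicontinuous:
  assumes "continuous_on UNIV f" "\<And>x. x \<notin> {l..r} \<Longrightarrow> f x = 0" "e > 0"
  shows "\<exists>d>0. \<forall>J x y. \<bar>y - x\<bar> < d \<longrightarrow> \<bar>conv X J f y - conv X J f x\<bar> \<le> e"
proof -
  obtain K where K: "K > 0" "\<And>J. (\<Sum>\<beta><X * 2 ^ J. \<bar>R J $ \<beta>\<bar>) \<le> K" using conv_bound by blast
  obtain d where d: "d > 0" "\<And>s t. \<bar>s - t\<bar> < d \<Longrightarrow> \<bar>f s - f t\<bar> < e / K"
    using uniform_modulus_of_compact_support[where l = l and r = r, OF assms(1,2), of "e / K"] \<open>e > 0\<close> K(1) by auto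
  have "\<bar>conv X J f y - conv X J f x\<bar> \<le> K * (e / K)" if "\<bar>y - x\<bar> < d" for J x y
    using K(1) \<open>e > 0\<close> that by (intro conv_diff_le K less_imp_le[OF d(2)]) auto
  then show ?thesis using d(1) K(1) by auto
qed

text \<open>Differentiation commutes with \<open>conv\<close>, and the uniform modulus of the next
  derivative of \<open>u\<close> times the coefficient bound makes the differentiated combinations
  equicontinuous uniformly in \<open>J\<close>. The convergence of the derivatives is carried
  through the induction because \<open>pointwise_limit_has_derivative\<close> consumes it at the
  next order.\<close>

lemma C_on_reals_transfer:
  assumes "C_on_reals k u"
  shows "C_on_reals k w \<and>
    (\<forall>X x. x < l + H * real X \<longrightarrow> (\<lambda>J. conv X J ((deriv ^^ k) u) x) \<longlonglongrightarrow> (deriv ^^ k) w x)"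
  using assms
proof (induction k)
  case 0
  then show ?case using w_cont conv_limit by (simp add: C_on_reals_def)
next
  case (Suc k)
  from Suc.prems have uk: "C_on_reals k u" "\<And>x. (deriv ^^ k) u differentiable at x"
    and cont: "continuous_on UNIV ((deriv ^^ Suc k) u)" by (auto simp: C_on_reals_Suc_iff)
  have der: "((deriv ^^ k) u has_real_derivative (deriv ^^ Suc k) u x) (at x)" for x
    using uk(2)[of x] by (simp add: DERIV_deriv_iff_real_differentiable)
  have equi: "\<exists>d>0. \<forall>J x y. \<bar>y - x\<bar> < d \<longrightarrow>
      \<bar>conv X J ((deriv ^^ Suc k) u) y - conv X J ((deriv ^^ Suc k) u) x\<bar> \<le> e" if "e > 0" for e X
    using that by (intro conv_equicontinuous cont higher_deriv_vanishes[where l = l and r = r] u_supp) auto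
  have ex: "\<exists>L. (\<lambda>J. conv X J ((deriv ^^ Suc k) u) x) \<longlonglongrightarrow> L \<and> ((deriv ^^ k) w has_real_derivative L) (at x)"
    if "x < l + H * real X" for X x
  proof (rule pointwise_limit_has_derivative[where S = "{..<l + H * real X}" and G = "\<lambda>J. conv X J ((deriv ^^ k) u)"])
    show "(\<lambda>J. conv X J ((deriv ^^ k) u) y) \<longlonglongrightarrow> (deriv ^^ k) w y" if "y \<in> {..<l + H * real X}" for y
      using Suc.IH[OF uk(1)] that by auto
    show "\<exists>d>0. \<forall>J y. \<bar>y - x\<bar> < d \<longrightarrow>
        \<bar>conv X J ((deriv ^^ Suc k) u) y - conv X J ((deriv ^^ Suc k) u) x\<bar> \<le> e" if "e > 0" for e
      using equi[OF that] by blast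
  qed (use that der in \<open>auto intro: conv_has_derivative\<close>)
  have wder: "((deriv ^^ k) w has_real_derivative (deriv ^^ Suc k) w x) (at x)"
    if "x < l + H * real X" for X x
    using ex[OF that] DERIV_imp_deriv[of "(deriv ^^ k) w"] by auto
  have lim: "(\<lambda>J. conv X J ((deriv ^^ Suc k) u) x) \<longlonglongrightarrow> (deriv ^^ Suc k) w x"
    if "x < l + H * real X" for X x
    using ex[OF that] wder[OF that] DERIV_unique by blast
  have arch: "\<exists>X. x < l + H * real X" for x
    using reals_Archimedean2[of "(x - l) / H"] H by (auto simp: field_simps)
  have "isCont ((deriv ^^ Suc k) w) x" for x
    unfolding continuous_at_eps_delta
  proof (intro allI impI)
    fix e :: real assume "e > 0"
    \<comment> \<open>The extra 1 keeps every point within distance 1 of \<open>x\<close> in the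
      region where the combinations converge.\<close>
    obtain X where X: "x + 1 < l + H * real X" using arch by blast
    obtain d where d: "d > 0" "\<And>J s t. \<bar>t - s\<bar> < d \<Longrightarrow>
        \<bar>conv X J ((deriv ^^ Suc k) u) t - conv X J ((deriv ^^ Suc k) u) s\<bar> \<le> e / 2"
      using equi[of "e / 2" X] \<open>e > 0\<close> by auto
    have "\<bar>(deriv ^^ Suc k) w y - (deriv ^^ Suc k) w x\<bar> \<le> e / 2" if "\<bar>y - x\<bar> < min d 1" for y
    proof (rule LIMSEQ_le_const2)
      show "(\<lambda>J. \<bar>conv X J ((deriv ^^ Suc k) u) y - conv X J ((deriv ^^ Suc k) u) x\<bar>)
          \<longlonglongrightarrow> \<bar>(deriv ^^ Suc k) w y - (deriv ^^ Suc k) w x\<bar>"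
        using that X by (intro tendsto_intros lim) auto
    qed (use d(2) that in auto)
    then have "\<forall>y. dist y x < min d 1 \<longrightarrow> dist ((deriv ^^ Suc k) w y) ((deriv ^^ Suc k) w x) < e"
      using \<open>e > 0\<close> by (fastforce simp: dist_real_def simp del: funpow.simps)
    then show "\<exists>d>0. \<forall>x'. dist x' x < d \<longrightarrow> dist ((deriv ^^ Suc k) w x') ((deriv ^^ Suc k) w x) < e"
      using d(1) by (intro exI[of _ "min d 1"]) auto
  qed
  moreover have "(deriv ^^ k) w differentiable at x" for x
    using arch wder real_differentiable_def by blast
  ultimately have "C_on_reals (Suc k) w"
    using Suc.IH[OF uk(1)] by (simp add: C_on_reals_Suc_iff continuous_on_eq_continuous_at del: funpow.simps)
  then show ?case using lim by blast
qed

text \<open>Each combination of translates has the Hoelder constant of \<open>u\<close> times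
  \<open>K\<close>, and the estimate passes to the limit. The bound \<open>K\<close> belongs to one
  fixed \<open>X\<close>, so this is local; the vanishing of \<open>w\<close> beyond
  \<open>r\<close> makes it global.\<close>

lemma hoelder_transfer:
  assumes "C_on_reals k u" "0 \<le> \<nu>"
    and c: "\<And>x y. \<bar>(deriv ^^ k) u x - (deriv ^^ k) u y\<bar> \<le> c * \<bar>x - y\<bar> powr \<nu>"
  shows "\<exists>c. \<forall>x y. \<bar>(deriv ^^ k) w x - (deriv ^^ k) w y\<bar> \<le> c * \<bar>x - y\<bar> powr \<nu>"
proof -
  obtain X where X: "(r + 1 - l) / H < real X" using reals_Archimedean2 by blast
  then have X: "r + 1 < l + H * real X" using H by (simp add: field_simps)
  obtain K where K: "K > 0" "\<And>J. (\<Sum>\<beta><X * 2 ^ J. \<bar>R J $ \<beta>\<bar>) \<le> K" using conv_bound by blast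
  have "0 \<le> c" using c[of 0 1] by simp
  let ?g = "(deriv ^^ k) w"
  have loc: "\<bar>?g x - ?g y\<bar> \<le> K * c * \<bar>x - y\<bar> powr \<nu>" if "x \<le> r + 1" "y \<le> r + 1" for x y
  proof (rule LIMSEQ_le_const2)
    show "(\<lambda>J. \<bar>conv X J ((deriv ^^ k) u) x - conv X J ((deriv ^^ k) u) y\<bar>) \<longlonglongrightarrow> \<bar>?g x - ?g y\<bar>"
      using C_on_reals_transfer[OF assms(1)] that X by (intro tendsto_intros) auto
    have "\<bar>conv X J ((deriv ^^ k) u) x - conv X J ((deriv ^^ k) u) y\<bar> \<le> K * (c * \<bar>x - y\<bar> powr \<nu>)" for J
    proof (rule conv_diff_le[OF K(2)])
      show "\<bar>(deriv ^^ k) u (x - t) - (deriv ^^ k) u (y - t)\<bar> \<le> c * \<bar>x - y\<bar> powr \<nu>" for t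
        using c[of "x - t" "y - t"] by simp
    qed (use \<open>0 \<le> c\<close> in simp)
    then show "\<exists>N. \<forall>J\<ge>N. \<bar>conv X J ((deriv ^^ k) u) x - conv X J ((deriv ^^ k) u) y\<bar>
        \<le> K * c * \<bar>x - y\<bar> powr \<nu>" by (simp add: mult.assoc)
  qed
  have vanish: "?g x = 0" if "x > r" for x
    using higher_deriv_vanishes[where l = l and r = r, OF w_supp] that by simp
  have le: "\<bar>?g x - ?g y\<bar> \<le> K * c * \<bar>x - y\<bar> powr \<nu>" if "x \<le> y" for x y
  proof (cases "y \<le> r + 1")
    case True
    then show ?thesis using that by (intro loc) auto
  next
    case y: False
    show ?thesis
    proof (cases "x \<le> r")
      case True
      \<comment> \<open>\<open>y\<close> is pulled back to \<open>r + 1\<close>, where the value is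
        also 0; this can only shorten the distance to \<open>x\<close>.\<close>
      have "\<bar>?g x - ?g y\<bar> = \<bar>?g x - ?g (r + 1)\<bar>" using vanish y by simp
      also have "\<dots> \<le> K * c * \<bar>x - (r + 1)\<bar> powr \<nu>" using True by (intro loc) auto
      also have "\<dots> \<le> K * c * \<bar>x - y\<bar> powr \<nu>"
        using True y K(1) \<open>0 \<le> c\<close> \<open>0 \<le> \<nu>\<close> by (intro mult_left_mono powr_mono2) auto
      finally show ?thesis .
    next
      case False
      then show ?thesis using vanish y K(1) \<open>0 \<le> c\<close> by simp
    qed
  qed
  have "\<bar>?g x - ?g y\<bar> \<le> K * c * \<bar>x - y\<bar> powr \<nu>" for x y
    using le[of x y] le[of y x] by (cases "x \<le> y") (simp_all add: abs_minus_commute)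
  then show ?thesis by blast
qed

end

section \<open>Power series with summable coefficients and cascades\<close>

text \<open>A truncated l1 norm. Coefficients of a product below \<open>N\<close> involve only those
  of the factors below \<open>N\<close>, so it is submultiplicative even on series that are not
  absolutely summable.\<close>

definition l1_upto :: "nat \<Rightarrow> 'a::real_normed_field fps \<Rightarrow> real" where
  "l1_upto N f = (\<Sum>i<N. norm (f $ i))"

lemma l1_upto_nonneg [simp]: "l1_upto N f \<ge> 0"
  by (simp add: l1_upto_def sum_nonneg)

lemma l1_upto_1: "l1_upto N 1 \<le> 1"
  by (cases N) (simp_all add: l1_upto_def sum.lessThan_Suc_shift del: sum.lessThan_Suc)

lemma l1_upto_add: "l1_upto N (f + g) \<le> l1_upto N f + l1_upto N g"
  by (simp add: l1_upto_def sum.distrib[symmetric] sum_mono norm_triangle_ineq)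

lemma l1_upto_uminus [simp]: "l1_upto N (- f) = l1_upto N f"
  by (simp add: l1_upto_def)

lemma l1_upto_mult: "l1_upto N (f * g) \<le> l1_upto N f * l1_upto N g"
proof -
  have "l1_upto N (f * g) \<le> (\<Sum>i<N. \<Sum>j\<le>i. norm (f $ j) * norm (g $ (i - j)))"
    unfolding l1_upto_def fps_mult_nth atLeast0AtMost
    by (intro sum_mono order_trans[OF norm_sum]) (simp add: norm_mult)
  also have "\<dots> = (\<Sum>(i, j)\<in>(SIGMA i:{..<N}. {..i}). norm (f $ j) * norm (g $ (i - j)))"
    by (subst sum.Sigma) auto
  also have "\<dots> = (\<Sum>(j, k)\<in>{(j, k). j + k < N}. norm (f $ j) * norm (g $ k))"
    by (rule sum.reindex_bij_witness[of _ "\<lambda>(j, k). (j + k, j)" "\<lambda>(i, j). (j, i - j)"]) auto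
  also have "\<dots> \<le> (\<Sum>(j, k)\<in>{..<N} \<times> {..<N}. norm (f $ j) * norm (g $ k))"
    by (rule sum_mono2) auto
  also have "\<dots> = l1_upto N f * l1_upto N g"
    by (simp add: l1_upto_def sum_product sum.cartesian_product)
  finally show ?thesis .
qed

lemma l1_upto_prod: "l1_upto N (\<Prod>j\<in>A. f j) \<le> (\<Prod>j\<in>A. l1_upto N (f j))"
proof (induction A rule: infinite_finite_induct)
  case (insert x F)
  then show ?case
    by (simp add: order_trans[OF l1_upto_mult] mult_left_mono)
qed (simp_all add: l1_upto_1)

text \<open>Substituting a power only inserts gaps. Hence a series of integer shifts has the same
  norm on every grid level.\<close>

lemma l1_upto_dilate:
  assumes "m > 0"
  shows "l1_upto (X * m) (f oo fps_X ^ m) = l1_upto X f"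
proof -
  have "l1_upto (X * m) (f oo fps_X ^ m) = (\<Sum>i | i < X * m \<and> m dvd i. norm (f $ (i div m)))"
    unfolding l1_upto_def using assms
    by (intro sum.mono_neutral_cong_right) (auto simp: fps_nth_compose_X_power)
  also have "\<dots> = l1_upto X f"
    unfolding l1_upto_def using assms
    by (intro sum.reindex_bij_witness[of _ "\<lambda>k. k * m" "\<lambda>i. i div m"]) (auto simp: less_mult_imp_div_less)
  finally show ?thesis .
qed

section \<open>Ratios of linear factors with nearby exponential nodes\<close>

lemma exp_diff_le:
  fixes a b c :: real
  assumes "\<bar>a\<bar> \<le> c" "\<bar>b\<bar> \<le> c"
  shows "\<bar>exp a - exp b\<bar> \<le> \<bar>a - b\<bar> * exp c"
proof -
  have "exp a - exp b \<le> \<bar>a - b\<bar> * exp c" if "\<bar>a\<bar> \<le> c" "\<bar>b\<bar> \<le> c" for a b :: real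
  proof -
    have "1 - exp (b - a) \<le> a - b" using exp_ge_add_one_self[of "b - a"] by linarith
    then have "exp a * (1 - exp (b - a)) \<le> exp a * (a - b)" by (intro mult_left_mono) auto
    then have "exp a - exp b \<le> exp a * (a - b)" by (simp add: right_diff_distrib flip: exp_add)
    also have "\<dots> \<le> exp a * \<bar>a - b\<bar>" by (intro mult_left_mono) auto
    also have "\<dots> \<le> exp c * \<bar>a - b\<bar>" using that by (intro mult_right_mono) auto
    finally show ?thesis by (simp add: mult.commute)
  qed
  from this[of a b] this[of b a] assms show ?thesis by (auto simp: abs_minus_commute)
qed

text \<open>The sign makes (1 + e y)(1 - e y) = 1 - e^2 y^2 the telescoping step for the mask
  factors.\<close>

definition lin :: "real \<Rightarrow> real fps" where
  "lin e = 1 - fps_const e * fps_X"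

lemma lin_nth_0 [simp]: "lin e $ 0 = 1"
  by (simp add: lin_def)

lemma lin_inverse [simp]: "lin e * inverse (lin e) = 1"
  by (rule inverse_mult_eq_1') simp

lemma inverse_lin: "inverse (lin e) = Abs_fps (\<lambda>i. e ^ i)"
proof (rule fps_inverse_unique, rule fps_ext)
  show "(lin e * Abs_fps (\<lambda>i. e ^ i)) $ i = 1 $ i" for i
    by (cases i) (simp_all add: lin_def left_diff_distrib mult.assoc)
qed

lemma lin_ratio_nth:
  "(lin e * inverse (lin e')) $ i = (if i = 0 then 1 else (e' - e) * e' ^ (i - 1))"
  unfolding inverse_lin by (cases i) (simp_all add: lin_def left_diff_distrib mult.assoc)

text \<open>After the leading 1 the quotient is a geometric series scaled by the difference of the
  nodes. The \<open>max\<close> covers nodes on either side of 1.\<close>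

lemma l1_upto_lin_ratio:
  assumes "e' > 0"
  shows "l1_upto N (lin e * inverse (lin e')) \<le> 1 + \<bar>e' - e\<bar> * (real N * max 1 e' ^ N)"
proof (cases N)
  case (Suc M)
  have "l1_upto N (lin e * inverse (lin e')) = 1 + (\<Sum>i<M. \<bar>e' - e\<bar> * e' ^ i)"
    using assms by (simp add: l1_upto_def Suc lin_ratio_nth sum.lessThan_Suc_shift abs_mult del: sum.lessThan_Suc)
  also have "(\<Sum>i<M. \<bar>e' - e\<bar> * e' ^ i) \<le> (\<Sum>i<M. \<bar>e' - e\<bar> * max 1 e' ^ N)"
  proof (intro sum_mono mult_left_mono)
    fix i assume "i \<in> {..<M}"
    have "e' ^ i \<le> max 1 e' ^ i" using assms by (intro power_mono) auto
    also have "\<dots> \<le> max 1 e' ^ N" using \<open>i \<in> {..<M}\<close> Suc by (intro power_increasing) auto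
    finally show "e' ^ i \<le> max 1 e' ^ N" .
  qed auto
  also have "\<dots> \<le> \<bar>e' - e\<bar> * (real N * max 1 e' ^ N)"
    unfolding sum_constant card_lessThan mult.left_commute[of "real M"]
    using Suc by (intro mult_left_mono mult_right_mono) auto
  finally show ?thesis by simp
qed (simp add: l1_upto_def)

text \<open>There are \<open>X * 2 ^ J\<close> coefficients, but the nodes differ by O(2^-J) and the
  powers involved are at most exp(X |t|), so the factors 2^J cancel.\<close>

lemma l1_upto_exp_lin_ratio:
  fixes s t :: real
  shows "\<exists>K. \<forall>J. l1_upto (X * 2 ^ J) (lin (exp (s / 2 ^ J)) * inverse (lin (exp (t / 2 ^ J)))) \<le> K"
proof (intro exI allI)
  fix J :: nat
  define c where "c = max \<bar>s\<bar> \<bar>t\<bar>"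
  have half: "\<bar>a / 2 ^ J\<bar> \<le> c" if "\<bar>a\<bar> \<le> c" for a :: real
  proof -
    have "\<bar>a / 2 ^ J\<bar> \<le> \<bar>a\<bar>" by (simp add: abs_divide divide_le_eq mult_le_cancel_left1)
    then show ?thesis using that by linarith
  qed
  have diff: "\<bar>exp (t / 2 ^ J) - exp (s / 2 ^ J)\<bar> \<le> \<bar>t / 2 ^ J - s / 2 ^ J\<bar> * exp c"
    by (intro exp_diff_le half) (auto simp: c_def)
  have "max 1 (exp (t / 2 ^ J)) \<le> exp (\<bar>t\<bar> / 2 ^ J)"
    by (auto intro: divide_right_mono)
  then have "max 1 (exp (t / 2 ^ J)) ^ (X * 2 ^ J) \<le> exp (\<bar>t\<bar> / 2 ^ J) ^ (X * 2 ^ J)"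
    by (intro power_mono) auto
  also have "\<dots> = exp (real X * \<bar>t\<bar>)" by (simp flip: exp_of_nat_mult)
  finally have pw: "max 1 (exp (t / 2 ^ J)) ^ (X * 2 ^ J) \<le> exp (real X * \<bar>t\<bar>)" .
  have "l1_upto (X * 2 ^ J) (lin (exp (s / 2 ^ J)) * inverse (lin (exp (t / 2 ^ J))))
      \<le> 1 + \<bar>exp (t / 2 ^ J) - exp (s / 2 ^ J)\<bar> * (real (X * 2 ^ J) * max 1 (exp (t / 2 ^ J)) ^ (X * 2 ^ J))"
    by (rule l1_upto_lin_ratio) simp
  also have "\<dots> \<le> 1 + (\<bar>t / 2 ^ J - s / 2 ^ J\<bar> * exp c) * (real (X * 2 ^ J) * exp (real X * \<bar>t\<bar>))"
    using diff pw by (intro add_left_mono mult_mono) auto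
  also have "\<dots> = 1 + \<bar>t - s\<bar> * exp c * (real X * exp (real X * \<bar>t\<bar>))"
    by (simp add: diff_divide_distrib[symmetric] abs_divide)
  finally show "l1_upto (X * 2 ^ J) (lin (exp (s / 2 ^ J)) * inverse (lin (exp (t / 2 ^ J))))
      \<le> 1 + \<bar>t - s\<bar> * exp (max \<bar>s\<bar> \<bar>t\<bar>) * (real X * exp (real X * \<bar>t\<bar>))"
    by (simp add: c_def)
qed

text \<open>Only finitely many factors escape the bound by \<epsilon>, so the positive excesses over
  1 are summable, and the product is at most the exponential of their sum.\<close>

lemma prod_le_of_summable_excess:
  fixes b :: "nat \<Rightarrow> real"
  assumes "\<And>i. b i \<ge> 0" "summable \<epsilon>" "\<And>i. i \<ge> I \<Longrightarrow> b i \<le> 1 + \<epsilon> i" "\<And>i. \<epsilon> i \<ge> 0"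
  shows "\<exists>K. \<forall>J. (\<Prod>i<J. b i) \<le> K"
proof -
  define t where "t i = max 0 (b i - 1)" for i
  have "summable t"
  proof (rule summable_comparison_test)
    have "norm (t i) \<le> \<epsilon> i" if "i \<ge> I" for i
      using assms(3)[OF that] assms(4)[of i] by (simp add: t_def)
    then show "\<exists>N. \<forall>n\<ge>N. norm (t n) \<le> \<epsilon> n" by blast
  qed (fact assms(2))
  have "(\<Prod>i<J. b i) \<le> exp (suminf t)" for J
  proof -
    have "b i \<le> exp (t i)" for i
    proof -
      have "b i \<le> 1 + t i" by (simp add: t_def)
      then show ?thesis using exp_ge_add_one_self[of "t i"] by linarith
    qed
    then have "(\<Prod>i<J. b i) \<le> (\<Prod>i<J. exp (t i))" using assms(1) by (intro prod_mono) auto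
    also have "\<dots> = exp (\<Sum>i<J. t i)" by (simp add: exp_sum)
    also have "\<dots> \<le> exp (suminf t)"
      using sum_le_suminf[OF \<open>summable t\<close>, of "{..<J}"] by (simp add: t_def)
    finally show ?thesis .
  qed
  then show ?thesis by blast
qed

section \<open>Cascade products and their quotients\<close>

text \<open>The generating function of \<^term>\<open>subdivide a J delta_seq\<close>, for masks with generating functions \<open>A J\<close>.\<close>

primrec cascade :: "(nat \<Rightarrow> real fps) \<Rightarrow> nat \<Rightarrow> real fps" where
  "cascade A 0 = 1"
| "cascade A (Suc J) = A J * (cascade A J oo fps_X ^ 2)"

lemma cascade_mult: "cascade (\<lambda>J. A J * B J) J = cascade A J * cascade B J"
  by (induction J) (simp_all add: fps_compose_mult_distrib mult_ac)

lemma cascade_prod: "cascade (\<lambda>J. \<Prod>j\<in>S. A j J) J = (\<Prod>j\<in>S. cascade (A j) J)"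
proof (induction S rule: infinite_finite_induct)
  case (insert x F)
  then show ?case by (simp add: cascade_mult)
next
  case (infinite S)
  have "cascade (\<lambda>J. 1) J = 1" by (induction J) simp_all
  with infinite show ?case by simp
next
  case empty
  have "cascade (\<lambda>J. 1) J = 1" by (induction J) simp_all
  then show ?case by simp
qed

text \<open>In the cascade of length \<open>J\<close> the factor \<open>r i\<close> occurs dilated
  by 2^(J-1-i), so a window of \<open>X * 2 ^ J\<close> coefficients sees only
  \<open>X * 2 ^ Suc i\<close> of its own.\<close>

lemma l1_upto_cascade:
  "l1_upto (X * 2 ^ J) (cascade r J) \<le> (\<Prod>i<J. l1_upto (X * 2 ^ Suc i) (r i))"
proof (induction J)
  case (Suc J)
  have "l1_upto (X * 2 ^ Suc J) (cascade r (Suc J))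
      \<le> l1_upto (X * 2 ^ Suc J) (r J) * l1_upto (X * 2 ^ Suc J) (cascade r J oo fps_X ^ 2)"
    using l1_upto_mult by simp
  also have "l1_upto (X * 2 ^ Suc J) (cascade r J oo fps_X ^ 2) = l1_upto (X * 2 ^ J) (cascade r J)"
    using l1_upto_dilate[of 2 "X * 2 ^ J" "cascade r J"] by (simp add: mult_ac)
  also have "l1_upto (X * 2 ^ Suc J) (r J) * \<dots> \<le> l1_upto (X * 2 ^ Suc J) (r J) * (\<Prod>i<J. l1_upto (X * 2 ^ Suc i) (r i))"
    by (intro mult_left_mono Suc.IH) simp
  finally show ?case by (simp add: mult_ac)
qed (simp add: l1_upto_1)

text \<open>Squaring the node of step \<open>J\<close> gives that of step \<open>J - 1\<close>, and
  squaring the node of step 0 gives exp s; hence the division by \<open>2 ^ Suc J\<close>.\<close>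

definition exp_factor :: "real \<Rightarrow> nat \<Rightarrow> real fps" where
  "exp_factor s J = 1 + fps_const (exp (s / 2 ^ Suc J)) * fps_X"

text \<open>The telescoping product \<open>(1 + y)(1 + y\<^sup>2)(1 + y\<^sup>4) \<dots>\<close>.\<close>

lemma cascade_exp_factor:
  "cascade (exp_factor s) J * lin (exp (s / 2 ^ J)) = lin (exp s) oo fps_X ^ (2 ^ J)"
proof (induction J)
  case (Suc J)
  have "exp_factor s J * lin (exp (s / 2 ^ Suc J)) = 1 - fps_const (exp (s / 2 ^ Suc J) ^ 2) * fps_X ^ 2"
    by (simp add: exp_factor_def lin_def algebra_simps power2_eq_square flip: fps_const_mult)
  also have "exp (s / 2 ^ Suc J) ^ 2 = exp (s / 2 ^ J)"
    by (simp flip: exp_of_nat_mult)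
  also have "1 - fps_const \<dots> * fps_X ^ 2 = lin (exp (s / 2 ^ J)) oo fps_X ^ 2"
    by (simp add: lin_def fps_compose_sub_distrib fps_compose_mult_distrib)
  finally have *: "exp_factor s J * lin (exp (s / 2 ^ Suc J)) = lin (exp (s / 2 ^ J)) oo fps_X ^ 2" .
  have "cascade (exp_factor s) (Suc J) * lin (exp (s / 2 ^ Suc J))
      = (cascade (exp_factor s) J oo fps_X ^ 2) * (exp_factor s J * lin (exp (s / 2 ^ Suc J)))"
    by (simp add: mult_ac)
  also have "\<dots> = (cascade (exp_factor s) J * lin (exp (s / 2 ^ J))) oo fps_X ^ 2"
    by (simp only: * fps_compose_mult_distrib) (simp add: fps_compose_mult_distrib)
  also have "\<dots> = (lin (exp s) oo fps_X ^ (2 ^ J)) oo fps_X ^ 2" by (simp only: Suc.IH)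
  also have "\<dots> = lin (exp s) oo fps_X ^ (2 ^ Suc J)"
    by (simp add: fps_compose_assoc[symmetric] fps_compose_power[symmetric] power_mult[symmetric])
  finally show ?case .
qed simp

text \<open>The quotient of the telescoped forms for \<open>s\<close> and \<open>t\<close>, sorted
  by scale: a series in y^(2^J), which means integer shifts, and a series in y whose two nodes
  differ by O(2^-J).\<close>

lemma cascade_exp_factor_ratio:
  "cascade (exp_factor s) J =
     (((lin (exp s) * inverse (lin (exp t))) oo fps_X ^ (2 ^ J)) *
      (lin (exp (t / 2 ^ J)) * inverse (lin (exp (s / 2 ^ J))))) * cascade (exp_factor t) J"
proof -
  let ?m = "fps_X ^ (2 ^ J) :: real fps"
  have hom: "(f * g) oo ?m = (f oo ?m) * (g oo ?m)" for f g :: "real fps"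
    by (rule fps_compose_mult_distrib) simp
  have inv: "(inverse (lin (exp t)) oo ?m) * (lin (exp t) oo ?m) = 1"
    by (simp flip: hom add: mult.commute)
  have "cascade (exp_factor s) J = cascade (exp_factor s) J * lin (exp (s / 2 ^ J)) * inverse (lin (exp (s / 2 ^ J)))"
    by (simp add: mult.assoc)
  also have "\<dots> = (lin (exp s) oo ?m) * inverse (lin (exp (s / 2 ^ J)))"
    by (simp only: cascade_exp_factor)
  also have "\<dots> = (lin (exp s) oo ?m) * inverse (lin (exp (s / 2 ^ J))) * ((inverse (lin (exp t)) oo ?m) * (lin (exp t) oo ?m))"
    by (simp only: inv mult_1_right)
  also have "\<dots> = (((lin (exp s) * inverse (lin (exp t))) oo ?m) *
      inverse (lin (exp (s / 2 ^ J)))) * (cascade (exp_factor t) J * lin (exp (t / 2 ^ J)))"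
    by (simp only: cascade_exp_factor hom mult_ac)
  finally show ?thesis by (simp only: mult_ac)
qed

text \<open>\<open>R\<close> is an explicit product of quotients. Those in y^(2^J) are bounded by
  dilation invariance, those in y by the closeness of their nodes, and the cascade of the quotients
  of \<open>Q\<close> and \<open>Q'\<close> by a convergent product. \<open>near\<close> is demanded
  for all \<open>N\<close> because the window of the \<open>i\<close>-th such quotient grows like
  2^i.\<close>

lemma cascade_ratio:
  fixes Q Q' :: "nat \<Rightarrow> real fps" and s t :: "nat \<Rightarrow> real" and B B' :: "real fps" and n :: nat
  defines "A \<equiv> \<lambda>J. Q J * (\<Prod>j<n. exp_factor (s j) J)"
    and "A' \<equiv> \<lambda>J. Q' J * (\<Prod>j<n. exp_factor (t j) J)"
  assumes nz: "\<And>J. Q' J $ 0 \<noteq> 0" "B' $ 0 \<noteq> 0"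
    and eps: "summable \<epsilon>" "\<And>J. \<epsilon> J \<ge> 0"
    and near: "\<And>N J. J \<ge> I \<Longrightarrow> l1_upto N (Q J * inverse (Q' J)) \<le> 1 + \<epsilon> J"
  shows "\<exists>R. (\<forall>J. (B oo fps_X ^ (2 ^ J)) * cascade A J = R J * ((B' oo fps_X ^ (2 ^ J)) * cascade A' J)) \<and>
    (\<forall>X. \<exists>K. \<forall>J. l1_upto (X * 2 ^ J) (R J) \<le> K)"
proof -
  define r where "r J = Q J * inverse (Q' J)" for J
  define P where "P j J = lin (exp (s j)) * inverse (lin (exp (t j))) oo fps_X ^ (2 ^ J)" for j J
  define S where "S j J = lin (exp (t j / 2 ^ J)) * inverse (lin (exp (s j / 2 ^ J)))" for j J
  define R where "R J = (B * inverse B' oo fps_X ^ (2 ^ J)) * (cascade r J * (\<Prod>j<n. P j J * S j J))" for J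
  have hom: "(f * g) oo (fps_X ^ (2 ^ J)) = (f oo (fps_X ^ (2 ^ J))) * (g oo (fps_X ^ (2 ^ J)))"
    for f g :: "real fps" and J :: nat
    by (rule fps_compose_mult_distrib) simp
  have "B = B * inverse B' * B'" using nz(2) by (simp add: mult.assoc inverse_mult_eq_1)
  then have B: "B oo fps_X ^ (2 ^ J) = (B * inverse B' oo fps_X ^ (2 ^ J)) * (B' oo fps_X ^ (2 ^ J))" for J
    by (metis hom)
  have "Q J = r J * Q' J" for J using nz(1) by (simp add: r_def mult.assoc inverse_mult_eq_1)
  then have "cascade Q J = cascade r J * cascade Q' J" for J
    using cascade_mult[of r Q' J] by presburger
  moreover have "(\<Prod>j<n. cascade (exp_factor (s j)) J) =
      (\<Prod>j<n. P j J * S j J) * (\<Prod>j<n. cascade (exp_factor (t j)) J)" for J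
    unfolding prod.distrib[symmetric]
    by (rule prod.cong) (simp_all add: P_def S_def cascade_exp_factor_ratio[of "s _" J "t _"])
  ultimately have C: "cascade A J = cascade r J * (\<Prod>j<n. P j J * S j J) * cascade A' J" for J
    by (simp add: A_def A'_def cascade_mult cascade_prod mult_ac)
  have eq: "(B oo fps_X ^ (2 ^ J)) * cascade A J = R J * ((B' oo fps_X ^ (2 ^ J)) * cascade A' J)" for J
    unfolding R_def B[of J] C by (simp only: mult_ac)
  have "\<exists>K. \<forall>J. l1_upto (X * 2 ^ J) (R J) \<le> K" for X
  proof -
    obtain K1 where K1: "\<And>J. (\<Prod>i<J. l1_upto (X * 2 ^ Suc i) (r i)) \<le> K1"
      using prod_le_of_summable_excess[of "\<lambda>i. l1_upto (X * 2 ^ Suc i) (r i)" \<epsilon> I] eps near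
      by (auto simp: r_def)
    have "\<exists>K2. \<forall>j J. l1_upto (X * 2 ^ J) (S j J) \<le> K2 j"
      unfolding S_def by (intro choice allI l1_upto_exp_lin_ratio)
    then obtain K2 where K2: "\<And>j J. l1_upto (X * 2 ^ J) (S j J) \<le> K2 j" by blast
    define c where "c j = l1_upto X (lin (exp (s j)) * inverse (lin (exp (t j))))" for j
    have P: "l1_upto (X * 2 ^ J) (P j J) = c j" for j J
      unfolding P_def c_def by (rule l1_upto_dilate) simp
    have PS: "l1_upto (X * 2 ^ J) (P j J * S j J) \<le> c j * K2 j" for j J
      by (rule order_trans[OF l1_upto_mult]) (simp add: P mult_left_mono K2 c_def)
    have "l1_upto (X * 2 ^ J) (R J) \<le> l1_upto X (B * inverse B') * (K1 * (\<Prod>j<n. c j * K2 j))" for J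
    proof -
      have "l1_upto (X * 2 ^ J) (R J) \<le> l1_upto (X * 2 ^ J) (B * inverse B' oo fps_X ^ (2 ^ J)) *
          (l1_upto (X * 2 ^ J) (cascade r J) * l1_upto (X * 2 ^ J) (\<Prod>j<n. P j J * S j J))"
        unfolding R_def by (intro order_trans[OF l1_upto_mult] mult_left_mono l1_upto_mult) simp
      also have "l1_upto (X * 2 ^ J) (B * inverse B' oo fps_X ^ (2 ^ J)) = l1_upto X (B * inverse B')"
        by (rule l1_upto_dilate) simp
      also have "l1_upto X (B * inverse B') * (l1_upto (X * 2 ^ J) (cascade r J) * l1_upto (X * 2 ^ J) (\<Prod>j<n. P j J * S j J))
          \<le> l1_upto X (B * inverse B') * (K1 * (\<Prod>j<n. c j * K2 j))"
      proof (intro mult_left_mono mult_mono)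
        show "l1_upto (X * 2 ^ J) (cascade r J) \<le> K1"
          using order_trans[OF l1_upto_cascade K1] .
        then show "0 \<le> K1" using l1_upto_nonneg order_trans by blast
        have "l1_upto (X * 2 ^ J) (\<Prod>j<n. P j J * S j J) \<le> (\<Prod>j<n. l1_upto (X * 2 ^ J) (P j J * S j J))"
          by (rule l1_upto_prod)
        also have "\<dots> \<le> (\<Prod>j<n. c j * K2 j)" by (intro prod_mono) (simp add: PS)
        finally show "l1_upto (X * 2 ^ J) (\<Prod>j<n. P j J * S j J) \<le> (\<Prod>j<n. c j * K2 j)" .
      qed auto
      finally show ?thesis .
    qed
    then show ?thesis by blast
  qed
  with eq show ?thesis by blast
qed

section \<open>Zeros of the classical spectral factor\<close>

text \<open>Multiplication by the variable absorbs the excluded point 0.\<close>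

lemma poly_eqI_nonzero:
  fixes p q :: "'a::field_char_0 poly"
  assumes "\<And>z. z \<noteq> 0 \<Longrightarrow> poly p z = poly q z"
  shows "p = q"
proof -
  have "poly ([:0, 1:] * p) z = poly ([:0, 1:] * q) z" for z
    using assms[of z] by (cases "z = 0") simp_all
  then have "[:0, 1:] * p = [:0, 1:] * q" using poly_eq_poly_eq_iff by blast
  then show ?thesis by (subst (asm) mult_left_cancel) simp_all
qed

lemma poly_eq_sum_le:
  fixes p :: "'a::comm_semiring_1 poly"
  assumes "degree p \<le> d"
  shows "poly p z = (\<Sum>i\<le>d. coeff p i * z ^ i)"
  unfolding poly_altdef using assms
  by (intro sum.mono_neutral_left) (auto simp: coeff_eq_0)

text \<open>The reciprocal polynomial z^d p(1/z). The formal degree \<open>d\<close> in place of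
  \<open>degree p\<close> makes it linear in \<open>p\<close>, even when leading coefficients
  vanish.\<close>

definition rev_poly :: "nat \<Rightarrow> 'a::comm_semiring_1 poly \<Rightarrow> 'a poly" where
  "rev_poly d p = (\<Sum>i\<le>d. monom (coeff p (d - i)) i)"

lemma coeff_rev_poly: "coeff (rev_poly d p) i = (if i \<le> d then coeff p (d - i) else 0)"
proof -
  have "coeff (rev_poly d p) i = (\<Sum>j\<le>d. if j = i then coeff p (d - j) else 0)"
    unfolding rev_poly_def coeff_sum by (rule sum.cong) auto
  then show ?thesis by simp
qed

lemma degree_rev_poly: "degree (rev_poly d p) \<le> d"
  by (rule degree_le) (simp add: coeff_rev_poly)

lemma poly_rev_poly:
  fixes p :: "'a::field poly"
  assumes "degree p \<le> d" "z \<noteq> 0"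
  shows "poly (rev_poly d p) z = z ^ d * poly p (1 / z)"
proof -
  have "poly (rev_poly d p) z = (\<Sum>i\<le>d. coeff p (d - i) * z ^ i)"
    unfolding poly_eq_sum_le[OF degree_rev_poly] by (rule sum.cong) (auto simp: coeff_rev_poly)
  also have "\<dots> = (\<Sum>i\<le>d. coeff p i * z ^ (d - i))"
    by (rule sum.reindex_bij_witness[of _ "\<lambda>i. d - i" "\<lambda>i. d - i"]) auto
  also have "\<dots> = z ^ d * (\<Sum>i\<le>d. coeff p i * (1 / z) ^ i)"
    unfolding sum_distrib_left using assms(2)
    by (intro sum.cong) (auto simp: power_diff power_one_over field_simps)
  finally show ?thesis using poly_eq_sum_le[OF assms(1), of "1 / z"] by simp
qed

text \<open>Over the complex numbers the absence of common roots is coprimality; the induction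
  cancels one linear factor of \<open>p\<close> at a time.\<close>

lemma dvd_of_dvd_mult_no_common_root:
  fixes p u r :: "complex poly"
  assumes "p \<noteq> 0" "p dvd u * r" "\<And>z. poly p z = 0 \<Longrightarrow> poly r z \<noteq> 0"
  shows "p dvd u"
  using assms
proof (induction "degree p" arbitrary: p u)
  case 0
  then show ?case by (metis is_unit_iff_degree unit_imp_dvd)
next
  case (Suc k)
  then have "\<not> constant (poly p)" by (simp add: constant_degree)
  then obtain z where z: "poly p z = 0" using fundamental_theorem_of_algebra by blast
  then obtain p1 where p1: "p = [:- z, 1:] * p1" by (metis dvdE poly_eq_0_iff_dvd)
  have "poly (u * r) z = 0" using z Suc.prems(2) by (metis dvdE mult_zero_left poly_mult)
  then have "poly u z = 0" using Suc.prems(3)[OF z] by simp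
  then obtain u1 where u1: "u = [:- z, 1:] * u1" by (metis dvdE poly_eq_0_iff_dvd)
  have "[:- z, 1:] * p1 dvd [:- z, 1:] * (u1 * r)" using Suc.prems(2) by (simp only: p1 u1 mult.assoc)
  then have "p1 dvd u1 * r" by (subst (asm) dvd_mult_cancel_left) auto
  moreover have "p1 \<noteq> 0" using Suc.prems(1) p1 by auto
  moreover have "degree p = Suc (degree p1)"
    unfolding p1 using \<open>p1 \<noteq> 0\<close> by (subst degree_mult_eq) auto
  then have "degree p1 = k" using Suc.hyps(2) by simp
  moreover have "poly r w \<noteq> 0" if "poly p1 w = 0" for w using Suc.prems(3)[of w] that by (simp add: p1)
  ultimately have "p1 dvd u1" using Suc.hyps(1)[of p1 u1] by blast
  then show ?case unfolding p1 u1 by (rule mult_dvd_mono[OF dvd_refl])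
qed

definition sym_exp_factor :: "nat \<Rightarrow> (nat \<Rightarrow> complex) \<Rightarrow> complex \<Rightarrow> complex" where
  "sym_exp_factor n e z = (\<Prod>j<n. (1 + e j * z) * (1 + e j / z))"

lemma sym_exp_factor_1:
  assumes "z \<noteq> 0"
  shows "z ^ n * sym_exp_factor n (\<lambda>_. 1) z = (1 + z) ^ (2 * n)"
proof -
  have "z * ((1 + z) * (1 + 1 / z)) = (1 + z) ^ 2" using assms by (simp add: field_simps power2_eq_square)
  then show ?thesis
    by (simp add: sym_exp_factor_def power_mult_distrib[symmetric] power_mult)
qed

text \<open>The linear map \<open>s \<mapsto> s(z) E(z) + s(-z) E(-z)\<close> is injective on Laurent polynomials \<open>s\<close> of
  degree at most \<open>n - 1\<close>, where \<open>E(z) = ((1 + z) (1 + 1 / z))\<^sup>n\<close>: its kernel consists of multiples of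
  \<open>(1 - z)\<^sup>2\<^sup>n\<close>.\<close>

lemma symmetrized_product_injective:
  assumes "n \<ge> 1" "degree S \<le> 2 * (n - 1)"
    and f: "\<And>z. z \<noteq> 0 \<Longrightarrow> poly S z = z ^ (n - 1) * f z"
    and eq: "\<And>z. z \<noteq> 0 \<Longrightarrow> f z * sym_exp_factor n (\<lambda>_. 1) z + f (- z) * sym_exp_factor n (\<lambda>_. 1) (- z) = 0"
  shows "S = 0"
proof (rule ccontr)
  assume "S \<noteq> 0"
  let ?E = "sym_exp_factor n (\<lambda>_. 1)"
  have "poly (S * [:1, 1:] ^ (2 * n)) z = poly ((pcompose S [:0, -1:]) * [:1, -1:] ^ (2 * n)) z" if "z \<noteq> 0" for z
  proof -
    have "(- z) ^ n * ?E (- z) = (1 - z) ^ (2 * n)"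
      using sym_exp_factor_1[of "- z" n] that by simp
    then have "poly S (- z) * (1 - z) ^ (2 * n) = (- z) ^ (n - 1) * (- z) ^ n * (f (- z) * ?E (- z))"
      using f[of "- z"] that by (simp add: mult_ac)
    \<comment> \<open>The total exponent 2n - 1 is odd; its sign turns the vanishing sum into an
      equality of two polynomials.\<close>
    also have "(- z) ^ (n - 1) * (- z) ^ n = - (z ^ (n - 1) * z ^ n)"
      using assms(1) by (cases n) (simp_all add: power_minus[of z] mult_ac)
    also have "- (z ^ (n - 1) * z ^ n) * (f (- z) * ?E (- z)) = z ^ (n - 1) * z ^ n * (f z * ?E z)"
      using eq[OF that] by (simp add: add_eq_0_iff)
    also have "\<dots> = poly S z * (z ^ n * ?E z)" using f[OF that] by (simp add: mult_ac)
    also have "\<dots> = poly S z * (1 + z) ^ (2 * n)" by (simp only: sym_exp_factor_1[OF that])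
    finally show ?thesis by (simp add: poly_pcompose)
  qed
  then have "S * [:1, 1:] ^ (2 * n) = (pcompose S [:0, -1:]) * [:1, -1:] ^ (2 * n)"
    by (rule poly_eqI_nonzero)
  \<comment> \<open>(1 - z)^(2n) has no root in common with (1 + z)^(2n), so it divides
    \<open>S\<close>, whose degree is at most 2n - 2.\<close>
  then have "[:1, -1:] ^ (2 * n) dvd S * [:1, 1:] ^ (2 * n)" by simp
  then have "[:1, -1:] ^ (2 * n) dvd S"
    by (rule dvd_of_dvd_mult_no_common_root[rotated]) auto
  then have "degree ([:1, -1:] ^ (2 * n) :: complex poly) \<le> degree S" using \<open>S \<noteq> 0\<close> by (rule dvd_imp_degree_le)
  then show False using assms(1,2) by simp
qed

abbreviation cpoly :: "real poly \<Rightarrow> complex poly" where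
  "cpoly \<equiv> map_poly complex_of_real"

lemma coeff_cpoly [simp]: "coeff (cpoly p) i = complex_of_real (coeff p i)"
  by (simp add: coeff_map_poly)

lemma degree_cpoly [simp]: "degree (cpoly p) = degree p"
  by (rule degree_map_poly) simp

lemma poly_cpoly_of_real: "poly (cpoly p) (of_real x) = of_real (poly p x)"
  by (simp add: poly_altdef)

lemma poly_cpoly_cnj: "poly (cpoly p) (cnj z) = cnj (poly (cpoly p) z)"
  by (simp add: poly_altdef)

text \<open>What \<open>is_daubechies_mask\<close> says about \<open>q\<close> once d is eliminated:
  since a(z) a(1/z) = 2 d(z), the equation d(z) + d(-z) = 2 becomes one with right-hand side
  4.\<close>

definition spectral_factor :: "nat \<Rightarrow> (nat \<Rightarrow> real) \<Rightarrow> real poly \<Rightarrow> bool" where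
  "spectral_factor n \<mu> q \<longleftrightarrow> degree q = n - 1 \<and> poly q 1 > 0 \<and>
     (\<forall>z. poly (cpoly q) z = 0 \<longrightarrow> cmod z \<ge> 1) \<and>
     (\<forall>z. z \<noteq> 0 \<longrightarrow>
        poly (cpoly q) z * poly (cpoly q) (1 / z) * sym_exp_factor n (\<lambda>j. of_real (exp (\<mu> j))) z +
        poly (cpoly q) (- z) * poly (cpoly q) (- 1 / z) * sym_exp_factor n (\<lambda>j. of_real (exp (\<mu> j))) (- z) = 4)"

text \<open>The classical symbol \<open>d\<close> satisfies \<open>d'(z) = c z\<^sup>-\<^sup>2\<^sup>n (1 - z\<^sup>2)\<^sup>2\<^sup>n\<^sup>-\<^sup>1\<close>, since \<open>d'\<close> is even. A
  zero of \<open>q\<close> on the unit circle would be a double zero of \<open>d\<close> and hence a zero of \<open>d'\<close>.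
  Below, \<open>D\<close> and \<open>H\<close> are the numerators of \<open>d\<close> and \<open>d'\<close>.\<close>

lemma classical_spectral_factor_roots:
  assumes "n \<ge> 1" "spectral_factor n (\<lambda>_. 0) q" "poly (cpoly q) z0 = 0"
  shows "cmod z0 > 1"
proof -
  define Q where "Q = cpoly q"
  define M where "M = 2 * n - 1"
  have degQ: "degree Q = n - 1" and q1: "poly q 1 > 0"
    and out: "\<And>z. poly Q z = 0 \<Longrightarrow> cmod z \<ge> 1"
    and eq: "\<And>z. z \<noteq> 0 \<Longrightarrow> poly Q z * poly Q (1 / z) * sym_exp_factor n (\<lambda>_. 1) z +
        poly Q (- z) * poly Q (- 1 / z) * sym_exp_factor n (\<lambda>_. 1) (- z) = 4"
    using assms(2) by (auto simp: spectral_factor_def Q_def)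
  have Q1: "poly Q 1 \<noteq> 0" using q1 poly_cpoly_of_real[of q 1] by (simp add: Q_def)
  define G where "G = Q * rev_poly (n - 1) Q"
  define D where "D = G * [:1, 1:] ^ (2 * n)"
  define H where "H = [:0, 1:] * pderiv D - smult (of_nat M) D"
  have M: "M = (n - 1) + n" "odd M" using assms(1) by (auto simp: M_def)
  have polyD: "poly D z = z ^ M * (poly Q z * poly Q (1 / z) * sym_exp_factor n (\<lambda>_. 1) z)" if "z \<noteq> 0" for z
    using that sym_exp_factor_1[OF that, of n]
    by (simp add: D_def G_def M(1) power_add poly_rev_poly degQ flip: sym_exp_factor_1)
  have "poly (D - pcompose D [:0, -1:]) z = poly (monom 4 M) z" if "z \<noteq> 0" for z
  proof -
    have "poly (D - pcompose D [:0, -1:]) z = z ^ M * (poly Q z * poly Q (1 / z) * sym_exp_factor n (\<lambda>_. 1) z +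
        poly Q (- z) * poly Q (- 1 / z) * sym_exp_factor n (\<lambda>_. 1) (- z))"
      using that M(2) by (simp add: poly_pcompose polyD distrib_left)
    then show ?thesis by (simp only: eq[OF that]) (simp add: poly_monom)
  qed
  then have "D - pcompose D [:0, -1:] = monom 4 M" by (rule poly_eqI_nonzero)
  then have coeffD: "coeff D i - (- 1) ^ i * coeff D i = (if i = M then 4 else 0)" for i
    by (metis coeff_diff coeff_monom coeff_pcompose_linear)
  have Dodd: "coeff D i = 0" if "odd i" "i \<noteq> M" for i using coeffD[of i] that by simp
  have DM: "coeff D M = 2" using coeffD[of M] M(2) by simp
  \<comment> \<open>The weight \<open>i - M\<close> removes the only odd coefficient that
    \<open>D\<close> has, the one at \<open>M\<close>; so \<open>H\<close> is even.\<close>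
  have coeffH: "coeff H i = (of_nat i - of_nat M) * coeff D i" for i
    by (cases i) (auto simp: H_def coeff_pCons coeff_pderiv algebra_simps)
  have "coeff H i = 0" if "odd i" for i using Dodd[OF that] by (cases "i = M") (simp_all add: coeffH)
  then have Heven: "poly H (- z) = poly H z" for z
    unfolding poly_altdef by (intro sum.cong) (auto simp: uminus_power_if)
  have "degree G \<le> (n - 1) + (n - 1)"
    unfolding G_def using degree_mult_le[of Q "rev_poly (n - 1) Q"] degree_rev_poly[of "n - 1" Q] degQ by linarith
  then have degD: "degree D \<le> 2 * M"
    using degree_mult_le[of G "[:1, 1:] ^ (2 * n)"] M(1) by (simp add: D_def degree_linear_power)
  have degH: "degree H \<le> 2 * M"
    by (rule degree_le) (use degD in \<open>auto simp: coeffH coeff_eq_0\<close>)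
  have "H \<noteq> 0"
  proof
    assume "H = 0"
    then have "coeff D i = 0" if "i \<noteq> M" for i using coeffH[of i] that by simp
    then have "D = monom 2 M" using DM by (intro poly_eqI) auto
    then have "poly D (- 1) \<noteq> 0" by (simp add: poly_monom)
    then show False using assms(1) by (simp add: D_def)
  qed
  have pow: "[:1, 1:] ^ (2 * n) = [:1, 1:] * ([:1, 1:] ^ M :: complex poly)"
    using assms(1) by (simp add: M_def flip: power_Suc)
  \<comment> \<open>Differentiation costs one of the \<open>k + M + 1\<close> factors 1 + z of
    \<open>D\<close>.\<close>
  have dvdH: "[:1, 1:] ^ (k + M) dvd H" if k: "[:1, 1:] ^ k dvd G" for k
  proof -
    obtain G1 where G1: "G = [:1, 1:] ^ k * G1" using k by blast
    then have D: "D = [:1, 1:] ^ (Suc (k + M)) * G1"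
      unfolding D_def pow G1 power_Suc power_add by (simp only: mult_ac)
    have le: "[:1, 1:] ^ (k + M) dvd ([:1, 1:] ^ Suc (k + M) :: complex poly)" by (rule le_imp_power_dvd) simp
    have "[:1, 1:] ^ (k + M) dvd pderiv D"
      unfolding D pderiv_mult pderiv_power_Suc
      by (rule dvd_add[OF dvd_mult2[OF le] dvd_mult[OF dvd_mult2[OF dvd_smult[OF dvd_refl]]]])
    moreover have "[:1, 1:] ^ (k + M) dvd D" unfolding D by (rule dvd_mult2[OF le])
    ultimately show ?thesis unfolding H_def by (intro dvd_diff dvd_smult dvd_mult)
  qed
  obtain K where K: "H = K * [:1, 1:] ^ M" using dvdH[of 0] by (metis add_0 dvdE mult.commute one_dvd power_0)
  \<comment> \<open>By evenness the factor (1 + z)^M is accompanied by (1 - z)^M, and a degree of at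
    most 2M leaves only a constant.\<close>
  have "poly (K * [:1, 1:] ^ M) z = poly (pcompose K [:0, -1:] * [:1, -1:] ^ M) z" for z
    using Heven[of z] by (simp add: K poly_pcompose)
  then have "K * [:1, 1:] ^ M = pcompose K [:0, -1:] * [:1, -1:] ^ M" using poly_eq_poly_eq_iff by blast
  then have "[:1, -1:] ^ M dvd K * [:1, 1:] ^ M" by simp
  then have "[:1, -1:] ^ M dvd K"
    by (rule dvd_of_dvd_mult_no_common_root[rotated]) auto
  then obtain L where L: "K = [:1, -1:] ^ M * L" by blast
  have "L \<noteq> 0" using \<open>H \<noteq> 0\<close> K L by auto
  have "degree H = M + degree L + M"
    unfolding K L using \<open>L \<noteq> 0\<close> by (subst degree_mult_eq, simp, simp)+ (simp add: degree_linear_power)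
  then have "degree L = 0" using degH by simp
  then obtain c where c: "L = [:c:]" "c \<noteq> 0" using \<open>L \<noteq> 0\<close> by (metis degree_eq_zeroE pCons_0_0)
  have H: "H = [:1, 1:] ^ M * (smult c ([:1, -1:] ^ M))" by (simp add: K L c mult_ac)
  have z0: "poly Q z0 = 0" using assms(3) by (simp add: Q_def)
  have "cmod z0 \<noteq> 1"
  proof
    assume one: "cmod z0 = 1"
    then have "z0 \<noteq> 0" by auto
    \<comment> \<open>As \<open>q\<close> is real, the conjugate of \<open>z0\<close> is a root too;
      hence both factors of \<open>G\<close> vanish at \<open>z0\<close>.\<close>
    have "1 / z0 = cnj z0"
      using one complex_norm_square[of z0] \<open>z0 \<noteq> 0\<close> by (simp add: field_simps)
    then have "poly Q (1 / z0) = 0" using z0 by (simp add: Q_def poly_cpoly_cnj)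
    then have rev0: "poly (rev_poly (n - 1) Q) z0 = 0"
      using poly_rev_poly[of Q "n - 1" z0] degQ \<open>z0 \<noteq> 0\<close> by simp
    have "poly G z0 = 0" "poly (pderiv G) z0 = 0" using z0 rev0 by (simp_all add: G_def pderiv_mult)
    then have "poly H z0 = 0" by (simp add: H_def D_def pderiv_mult)
    then have "1 + z0 = 0 \<or> 1 - z0 = 0" using c(2) by (auto simp: H)
    then have "z0 = -1 \<or> z0 = 1" by (auto simp: add_eq_0_iff)
    with z0 Q1 have "z0 = -1" by auto
    \<comment> \<open>A zero of \<open>q\<close> at -1 adds two factors 1 + z to \<open>D\<close>,
      raising the order of \<open>H\<close> there to at least \<open>M + 2\<close>; but its order is
      exactly \<open>M\<close>.\<close>
    then have "[:1, 1:] dvd Q" "[:1, 1:] dvd rev_poly (n - 1) Q"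
      using z0 rev0 by (auto simp: poly_eq_0_iff_dvd)
    then have sq: "[:1, 1:] ^ 2 dvd G" unfolding G_def power2_eq_square by (rule mult_dvd_mono)
    have "[:1, 1:] ^ M * [:1, 1:] ^ 2 dvd H" using dvdH[OF sq] by (simp only: power_add mult.commute)
    then have "[:1, 1:] ^ 2 dvd smult c ([:1, -1:] ^ M)"
      unfolding H by (subst (asm) dvd_mult_cancel_left) auto
    then have "[:1, 1:] dvd smult c ([:1, -1:] ^ M)" by (metis dvd_mult_left power2_eq_square)
    then have "poly (smult c ([:1, -1:] ^ M)) (- 1) = 0" by (metis minus_minus poly_eq_0_iff_dvd)
    then show False using c(2) by simp
  qed
  then show ?thesis using out[OF z0] by simp
qed

text \<open>A quantitative form of having no root in the open disc, made to survive limits of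
  polynomials. Each root z contributes |w - z| \<ge> |z| (1 - |w|) because |z| \<ge> 1.\<close>

lemma norm_poly_ge_of_roots_outside:
  fixes p :: "complex poly"
  assumes "p \<noteq> 0" "\<And>z. poly p z = 0 \<Longrightarrow> cmod z \<ge> 1" "cmod w \<le> 1"
  shows "cmod (poly p w) \<ge> cmod (poly p 0) * (1 - cmod w) ^ degree p"
  using assms(1,2)
proof (induction "degree p" arbitrary: p)
  case 0
  then obtain c where "p = [:c:]" by (metis degree_eq_zeroE)
  then show ?case by simp
next
  case (Suc k)
  then have "\<not> constant (poly p)" by (simp add: constant_degree)
  then obtain z where z: "poly p z = 0" using fundamental_theorem_of_algebra by blast
  then obtain p1 where p1: "p = [:- z, 1:] * p1" by (metis dvdE poly_eq_0_iff_dvd)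
  have p10: "p1 \<noteq> 0" using Suc.prems(1) p1 by auto
  have "degree p = Suc (degree p1)"
    unfolding p1 using p10 by (subst degree_mult_eq) auto
  then have deg: "degree p1 = k" using Suc.hyps(2) by simp
  have IH: "cmod (poly p1 0) * (1 - cmod w) ^ k \<le> cmod (poly p1 w)"
    using Suc.hyps(1)[of p1] p10 deg Suc.prems(2) by (simp add: p1)
  have "cmod z \<ge> 1" using Suc.prems(2) z by blast
  then have "cmod w * 1 \<le> cmod w * cmod z" by (intro mult_left_mono) auto
  then have "cmod z * (1 - cmod w) \<le> cmod z - cmod w" by (simp add: right_diff_distrib mult.commute)
  also have "\<dots> \<le> cmod (w - z)" using norm_triangle_ineq2[of z w] by (simp add: norm_minus_commute)
  finally have "(cmod z * (1 - cmod w)) * (cmod (poly p1 0) * (1 - cmod w) ^ k) \<le> cmod (w - z) * cmod (poly p1 w)"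
    using IH assms(3) by (intro mult_mono) auto
  moreover have "poly p w = (w - z) * poly p1 w" "poly p 0 = - z * poly p1 0"
    by (simp_all add: p1 algebra_simps)
  ultimately show ?case unfolding Suc.hyps(2)[symmetric] by (simp add: norm_mult mult_ac)
qed

section \<open>Convergence of the spectral factors\<close>

lemma cpoly_mult: "cpoly (p * r) = cpoly p * cpoly r"
  by (rule poly_eqI) (simp add: coeff_mult)

lemma poly_cpoly_mult_prod:
  fixes n :: nat
  shows "poly (cpoly (q * (\<Prod>j<n. [:1, e j:]))) z = poly (cpoly q) z * (\<Prod>j<n. 1 + of_real (e j) * z)"
proof -
  have "cpoly (\<Prod>j<n. [:1, e j:]) = (\<Prod>j<n. cpoly [:1, e j:])" for n :: nat
    by (induction n) (simp_all only: prod.lessThan_Suc cpoly_mult, simp)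
  then show ?thesis by (simp add: cpoly_mult poly_prod map_poly_pCons mult.commute)
qed

text \<open>The middle coefficient of z^M a(z) a(1/z) is the sum of the squared coefficients of
  \<open>a\<close>, and the factorization identity fixes it at 2.\<close>

lemma spectral_factor_bounded_coeffs:
  assumes "n \<ge> 1" "spectral_factor n \<mu> q"
    and a: "a = q * (\<Prod>j<n. [:1, exp (\<mu> j):])"
  shows "\<bar>coeff a i\<bar> \<le> 2"
proof -
  define M where "M = 2 * n - 1"
  have M: "odd M" "M = n - 1 + n" using assms(1) by (auto simp: M_def)
  define A where "A = cpoly a"
  have A: "poly A z = poly (cpoly q) z * (\<Prod>j<n. 1 + of_real (exp (\<mu> j)) * z)" for z
    by (simp add: A_def a poly_cpoly_mult_prod)
  have degA: "degree A \<le> M"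
  proof -
    have "degree (\<Prod>j<n. [:1, exp (\<mu> j):]) \<le> n"
      by (rule order_trans[OF degree_prod_sum_le]) auto
    then show ?thesis
      using degree_mult_le[of q "\<Prod>j<n. [:1, exp (\<mu> j):]"] assms(2) M(2) by (simp add: A_def a spectral_factor_def)
  qed
  have eq: "poly A z * poly A (1 / z) + poly A (- z) * poly A (- 1 / z) = 4" if "z \<noteq> 0" for z
    using assms(2) that by (auto simp: spectral_factor_def A sym_exp_factor_def prod.distrib mult_ac)
  define D where "D = A * rev_poly M A"
  have "poly (D - pcompose D [:0, -1:]) z = poly (monom 4 M) z" if "z \<noteq> 0" for z
  proof -
    have "poly (D - pcompose D [:0, -1:]) z = z ^ M * (poly A z * poly A (1 / z) + poly A (- z) * poly A (- 1 / z))"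
      using that M(1) by (simp add: D_def poly_pcompose poly_rev_poly[OF degA] distrib_left mult_ac)
    then show ?thesis by (simp only: eq[OF that]) (simp add: poly_monom)
  qed
  then have "D - pcompose D [:0, -1:] = monom 4 M" by (rule poly_eqI_nonzero)
  then have "coeff D M - (- 1) ^ M * coeff D M = 4"
    by (metis coeff_diff coeff_monom coeff_pcompose_linear)
  then have "coeff D M = 2" using M(1) by simp
  moreover have "coeff D M = (\<Sum>i\<le>M. coeff A i * coeff A i)"
    unfolding D_def coeff_mult by (rule sum.cong) (auto simp: coeff_rev_poly)
  ultimately have "complex_of_real (\<Sum>i\<le>M. (coeff a i)\<^sup>2) = of_real 2"
    by (simp add: A_def power2_eq_square)
  then have sum2: "(\<Sum>i\<le>M. (coeff a i)\<^sup>2) = 2" by (simp only: of_real_eq_iff)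
  show ?thesis
  proof (cases "i \<le> M")
    case True
    then have "(coeff a i)\<^sup>2 \<le> (\<Sum>i\<le>M. (coeff a i)\<^sup>2)" by (intro member_le_sum) auto
    then have "(coeff a i)\<^sup>2 \<le> 2\<^sup>2" using sum2 by simp
    then show ?thesis using abs_le_square_iff[of "coeff a i" 2] by simp
  next
    case False
    then show ?thesis using degA by (simp add: A_def coeff_eq_0)
  qed
qed

section \<open>Compactness and identification of limits of spectral factors\<close>

lemma finitely_many_convergent_subsequences:
  fixes v :: "nat \<Rightarrow> nat \<Rightarrow> real"
  assumes "\<And>k i. \<bar>v k i\<bar> \<le> B"
  shows "\<exists>l r. strict_mono r \<and> (\<forall>i<N. (\<lambda>k. v (r k) i) \<longlonglongrightarrow> l i)"
proof (induction N)
  case 0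
  show ?case by (auto intro: strict_mono_id[unfolded id_def])
next
  case (Suc N)
  then obtain l r where lr: "strict_mono r" "\<And>i. i < N \<Longrightarrow> (\<lambda>k. v (r k) i) \<longlonglongrightarrow> l i" by blast
  have "\<forall>k. v (r k) N \<in> {-B..B}" using assms by (simp add: abs_le_iff minus_le_iff)
  then obtain L s where L: "strict_mono s" "((\<lambda>k. v (r k) N) \<circ> s) \<longlonglongrightarrow> L"
    using compact_imp_seq_compact[OF compact_Icc, of "-B" B] seq_compactE by metis
  have "(\<lambda>k. v (r (s k)) i) \<longlonglongrightarrow> (l(N := L)) i" if "i < Suc N" for i
  proof (cases "i = N")
    case True
    then show ?thesis using L(2) by (simp add: o_def)
  next
    case False
    then have "i < N" using that by simp
    then show ?thesis using LIMSEQ_subseq_LIMSEQ[OF lr(2) L(1)] by (simp add: o_def)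
  qed
  moreover have "strict_mono (\<lambda>k. r (s k))" using strict_mono_o[OF lr(1) L(1)] by (simp add: o_def)
  ultimately show ?case by blast
qed

lemma bounded_poly_convergent_subsequence:
  fixes p :: "nat \<Rightarrow> real poly"
  assumes "\<And>k i. \<bar>coeff (p k) i\<bar> \<le> B" "\<And>k. degree (p k) \<le> d"
  obtains l r where "strict_mono r" "degree l \<le> d" "\<And>i. (\<lambda>k. coeff (p (r k)) i) \<longlonglongrightarrow> coeff l i"
proof -
  obtain l r where lr: "strict_mono r" "\<And>i. i < Suc d \<Longrightarrow> (\<lambda>k. coeff (p (r k)) i) \<longlonglongrightarrow> l i"
    using finitely_many_convergent_subsequences[of "\<lambda>k. coeff (p k)" B "Suc d"] assms(1) by blast
  define q where "q = (\<Sum>i\<le>d. monom (l i) i)"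
  have q: "coeff q i = (if i \<le> d then l i else 0)" for i
  proof -
    have "coeff q i = (\<Sum>j\<le>d. if j = i then l j else 0)"
      unfolding q_def coeff_sum by (rule sum.cong) auto
    then show ?thesis by simp
  qed
  show thesis
  proof (rule that[OF lr(1)])
    show "degree q \<le> d" by (rule degree_le) (simp add: q)
    show "(\<lambda>k. coeff (p (r k)) i) \<longlonglongrightarrow> coeff q i" for i
    proof (cases "i \<le> d")
      case False
      then have "coeff (p (r k)) i = 0" for k using assms(2)[of "r k"] by (intro coeff_eq_0) auto
      then show ?thesis using False by (simp add: q)
    qed (simp add: q lr(2))
  qed
qed

lemma tendsto_poly_cpoly:
  assumes "\<And>i. (\<lambda>k. coeff (p k) i) \<longlonglongrightarrow> coeff l i" "\<And>k. degree (p k) \<le> d" "degree l \<le> d"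
  shows "(\<lambda>k. poly (cpoly (p k)) z) \<longlonglongrightarrow> poly (cpoly l) z"
proof -
  have eq: "poly (cpoly q) z = (\<Sum>i\<le>d. of_real (coeff q i) * z ^ i)" if "degree q \<le> d" for q
    using poly_eq_sum_le[of "cpoly q" d z] that by simp
  show ?thesis unfolding eq[OF assms(2)] eq[OF assms(3)] by (intro tendsto_intros assms(1))
qed

text \<open>Provides the first-order variation under scaling of all frequencies by t, to be weighed
  against the change of the spectral factor in \<open>spectral_factor_rate\<close>.\<close>

lemma sym_exp_factor_derivative:
  assumes "z \<noteq> 0"
  shows "\<exists>D. ((\<lambda>t. sym_exp_factor n (\<lambda>j. exp (l j * t)) z) has_field_derivative D) (at 0)"
proof -
  have "(\<lambda>t. (1 + exp (l j * t) * z) * (1 + exp (l j * t) / z)) field_differentiable (at 0)" for j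
  proof -
    have "((\<lambda>t. (1 + exp (l j * t) * z) * (1 + exp (l j * t) / z)) has_field_derivative
        (1 + z) * (l j / z) + l j * z * (1 + 1 / z)) (at 0)"
      using assms by (auto intro!: derivative_eq_intros)
    then show ?thesis unfolding field_differentiable_def by blast
  qed
  then have "(\<lambda>t. \<Prod>j<n. (1 + exp (l j * t) * z) * (1 + exp (l j * t) / z)) field_differentiable (at 0)"
  proof (induction n)
    case 0
    show ?case by simp
  next
    case (Suc n)
    show ?case unfolding prod.lessThan_Suc
      by (intro field_differentiable_mult Suc)
  qed
  then show ?thesis by (simp add: sym_exp_factor_def field_differentiable_def)
qed

lemma degree_mult_rev_poly_le:
  assumes "degree p \<le> d"
  shows "degree (p * rev_poly d r) \<le> 2 * d"
  using degree_mult_le[of p "rev_poly d r"] degree_rev_poly[of d r] assms by linarith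

text \<open>The roots of the classical \<open>q\<close> have modulus above 1, while those of the
  reciprocal of \<open>r\<close> have modulus at most 1. So \<open>q\<close> divides
  \<open>u\<close> itself, and the degrees leave a constant.\<close>

lemma multiple_of_classical_factor:
  assumes "n \<ge> 1" "spectral_factor n (\<lambda>_. 0) q" "degree u \<le> n - 1" "degree r \<le> n - 1"
    and r: "\<And>z. poly (cpoly r) z = 0 \<Longrightarrow> cmod z \<ge> 1"
    and dvd: "cpoly q dvd cpoly u * rev_poly (n - 1) (cpoly r)"
  shows "\<exists>c. u = smult c q"
proof -
  have q: "degree q = n - 1" "q \<noteq> 0" using assms(2) by (auto simp: spectral_factor_def)
  have q0: "cpoly q \<noteq> 0" using q(2) by (simp add: map_poly_eq_0_iff)
  have "cpoly q dvd cpoly u"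
    using q0 dvd
  proof (rule dvd_of_dvd_mult_no_common_root)
    fix z assume "poly (cpoly q) z = 0"
    then have z: "cmod z > 1" using classical_spectral_factor_roots assms(1,2) by blast
    then have "z \<noteq> 0" by auto
    show "poly (rev_poly (n - 1) (cpoly r)) z \<noteq> 0"
    proof
      assume "poly (rev_poly (n - 1) (cpoly r)) z = 0"
      then have "poly (cpoly r) (1 / z) = 0"
        using poly_rev_poly[of "cpoly r" "n - 1" z] assms(4) \<open>z \<noteq> 0\<close> by simp
      then have "cmod (1 / z) \<ge> 1" by (rule r)
      then show False using z \<open>z \<noteq> 0\<close> by (simp add: norm_divide le_divide_eq)
    qed
  qed
  then obtain k where k: "cpoly u = cpoly q * k" by blast
  have "degree k = 0"
  proof (cases "k = 0")
    case False
    then have "degree (cpoly u) = degree (cpoly q) + degree k" unfolding k using q0 by (intro degree_mult_eq)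
    then show ?thesis using assms(3) q(1) by simp
  qed simp
  then obtain c where c: "k = [:c:]" by (metis degree_eq_zeroE)
  have "cpoly u = smult c (cpoly q)" by (simp add: k c)
  then have "complex_of_real (coeff u i) = c * of_real (coeff q i)" for i
    by (metis coeff_cpoly coeff_smult)
  \<comment> \<open>The constant is complex at this point; as \<open>u\<close> and \<open>q\<close>
    are real, its real part serves.\<close>
  then have "Re (complex_of_real (coeff u i)) = Re (c * of_real (coeff q i))" for i by simp
  then have "coeff u i = Re c * coeff q i" for i by simp
  then have "u = smult (Re c) q" by (intro poly_eqI) simp
  then show ?thesis by blast
qed

text \<open>Uniqueness of the classical factor, for limits. \<open>p\<close> solves the classical
  equation, so its product with its reciprocal is that of \<open>q\<close>. It has no root in the
  open disc, because the lower bounds pass to the limit, hence \<open>p\<close> = c q with c^2 = 1;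
  positivity at 1 decides the sign.\<close>

lemma spectral_factor_limit:
  fixes P :: "nat \<Rightarrow> real poly"
  assumes n: "n \<ge> 1" and q: "spectral_factor n (\<lambda>_. 0) q"
    and P: "\<And>k. spectral_factor n (\<lambda>j. \<Lambda> j * t k) (P k)" and t: "t \<longlonglongrightarrow> 0"
    and lim: "\<And>i. (\<lambda>k. coeff (P k) i) \<longlonglongrightarrow> coeff p i" and deg: "degree p \<le> n - 1"
  shows "p = q"
proof -
  let ?E = "sym_exp_factor n (\<lambda>_. 1)"
  have degq: "degree q = n - 1" and q1: "poly q 1 > 0" and q0: "q \<noteq> 0"
    and out: "\<And>z. poly (cpoly q) z = 0 \<Longrightarrow> cmod z \<ge> 1"
    and eq: "\<And>z. z \<noteq> 0 \<Longrightarrow> poly (cpoly q) z * poly (cpoly q) (1 / z) * ?E z +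
        poly (cpoly q) (- z) * poly (cpoly q) (- 1 / z) * ?E (- z) = 4"
    using q by (auto simp: spectral_factor_def)
  have degP: "degree (P k) \<le> n - 1" for k using P by (simp add: spectral_factor_def)
  note plim = tendsto_poly_cpoly[OF lim degP deg]
  have eqp: "poly (cpoly p) z * poly (cpoly p) (1 / z) * ?E z +
        poly (cpoly p) (- z) * poly (cpoly p) (- 1 / z) * ?E (- z) = 4" if "z \<noteq> 0" for z
  proof (rule LIMSEQ_unique)
    have "(\<lambda>k. complex_of_real (exp (\<Lambda> j * t k))) \<longlonglongrightarrow> 1" for j
    proof -
      have "(\<lambda>k. complex_of_real (exp (\<Lambda> j * t k))) \<longlonglongrightarrow> of_real (exp (\<Lambda> j * 0))"
        by (intro tendsto_intros t)
      then show ?thesis by simp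
    qed
    then have "(\<lambda>k. sym_exp_factor n (\<lambda>j. of_real (exp (\<Lambda> j * t k))) w) \<longlonglongrightarrow> ?E w" if "w \<noteq> 0" for w
      unfolding sym_exp_factor_def using that by (intro tendsto_intros)
    then show "(\<lambda>k. poly (cpoly (P k)) z * poly (cpoly (P k)) (1 / z) * sym_exp_factor n (\<lambda>j. of_real (exp (\<Lambda> j * t k))) z +
        poly (cpoly (P k)) (- z) * poly (cpoly (P k)) (- 1 / z) * sym_exp_factor n (\<lambda>j. of_real (exp (\<Lambda> j * t k))) (- z))
        \<longlonglongrightarrow> poly (cpoly p) z * poly (cpoly p) (1 / z) * ?E z + poly (cpoly p) (- z) * poly (cpoly p) (- 1 / z) * ?E (- z)"
      using that by (intro tendsto_intros plim) auto
    show "(\<lambda>k. poly (cpoly (P k)) z * poly (cpoly (P k)) (1 / z) * sym_exp_factor n (\<lambda>j. of_real (exp (\<Lambda> j * t k))) z +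
        poly (cpoly (P k)) (- z) * poly (cpoly (P k)) (- 1 / z) * sym_exp_factor n (\<lambda>j. of_real (exp (\<Lambda> j * t k))) (- z))
        \<longlonglongrightarrow> 4"
      using P that by (simp add: spectral_factor_def)
  qed
  let ?rev = "\<lambda>r. rev_poly (n - 1) (cpoly r)"
  have "cpoly p * ?rev p - cpoly q * ?rev q = 0"
  proof (rule symmetrized_product_injective[OF n])
    show "degree (cpoly p * ?rev p - cpoly q * ?rev q) \<le> 2 * (n - 1)"
      using deg degq by (intro degree_diff_le degree_mult_rev_poly_le) auto
    show "poly (cpoly p * ?rev p - cpoly q * ?rev q) z =
        z ^ (n - 1) * (poly (cpoly p) z * poly (cpoly p) (1 / z) - poly (cpoly q) z * poly (cpoly q) (1 / z))"
      if "z \<noteq> 0" for z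
      using that deg degq by (simp add: poly_rev_poly right_diff_distrib)
    show "(poly (cpoly p) z * poly (cpoly p) (1 / z) - poly (cpoly q) z * poly (cpoly q) (1 / z)) * ?E z +
        (poly (cpoly p) (- z) * poly (cpoly p) (1 / - z) - poly (cpoly q) (- z) * poly (cpoly q) (1 / - z)) * ?E (- z) = 0"
      if "z \<noteq> 0" for z
      using eq[OF that] eqp[OF that] by (simp add: algebra_simps)
  qed
  then have pq: "cpoly p * ?rev p = cpoly q * ?rev q" by simp
  \<comment> \<open>\<open>p\<close> must not vanish at 0, or the lower bound below would be empty.
    At 0 the reciprocal of \<open>q\<close> takes the leading coefficient of
    \<open>q\<close>.\<close>
  have "poly (cpoly p) 0 * poly (?rev p) 0 = poly (cpoly q) 0 * poly (?rev q) 0"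
    using pq by (metis poly_mult)
  moreover have "poly (?rev q) 0 \<noteq> 0"
    using q0 degq by (simp add: poly_0_coeff_0 coeff_rev_poly) (metis leading_coeff_0_iff)
  moreover have "poly (cpoly q) 0 \<noteq> 0" using out[of 0] by auto
  ultimately have p0: "poly (cpoly p) 0 \<noteq> 0" by auto
  have "cmod z \<ge> 1" if z: "poly (cpoly p) z = 0" for z
  proof (rule ccontr)
    assume "\<not> cmod z \<ge> 1"
    then have lt: "cmod z < 1" by simp
    have "cmod (poly (cpoly p) 0) * (1 - cmod z) ^ (n - 1) \<le> cmod (poly (cpoly p) z)"
    proof (rule LIMSEQ_le)
      show "(\<lambda>k. cmod (poly (cpoly (P k)) 0) * (1 - cmod z) ^ (n - 1)) \<longlonglongrightarrow> cmod (poly (cpoly p) 0) * (1 - cmod z) ^ (n - 1)"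
        by (intro tendsto_intros plim)
      show "(\<lambda>k. cmod (poly (cpoly (P k)) z)) \<longlonglongrightarrow> cmod (poly (cpoly p) z)"
        by (intro tendsto_intros plim)
      have "cmod (poly (cpoly (P k)) 0) * (1 - cmod z) ^ degree (cpoly (P k)) \<le> cmod (poly (cpoly (P k)) z)" for k
      proof (rule norm_poly_ge_of_roots_outside)
        show "cpoly (P k) \<noteq> 0" using P[of k] by (auto simp: spectral_factor_def map_poly_eq_0_iff)
        show "cmod w \<ge> 1" if "poly (cpoly (P k)) w = 0" for w using P[of k] that by (simp add: spectral_factor_def)
      qed (use lt in simp)
      then show "\<exists>N. \<forall>k\<ge>N. cmod (poly (cpoly (P k)) 0) * (1 - cmod z) ^ (n - 1) \<le> cmod (poly (cpoly (P k)) z)"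
        using P by (auto simp: spectral_factor_def)
    qed
    moreover have "0 < cmod (poly (cpoly p) 0) * (1 - cmod z) ^ (n - 1)"
      using p0 lt by (intro mult_pos_pos zero_less_power) auto
    ultimately show False using z by simp
  qed
  then obtain c where c: "p = smult c q"
    using multiple_of_classical_factor[OF n q deg deg] pq by (metis dvd_triv_left)
  have "cpoly p = smult (of_real c) (cpoly q)" by (intro poly_eqI) (simp add: c)
  moreover have "?rev p = smult (of_real c) (?rev q)" by (intro poly_eqI) (simp add: c coeff_rev_poly)
  ultimately have "smult (of_real (c * c)) (cpoly q * ?rev q) = smult 1 (cpoly q * ?rev q)" using pq by simp
  moreover have "poly (cpoly q * ?rev q) 0 \<noteq> 0" using \<open>poly (?rev q) 0 \<noteq> 0\<close> \<open>poly (cpoly q) 0 \<noteq> 0\<close> by simp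
  ultimately have "complex_of_real (c * c) = 1"
    by (metis mult_cancel_right poly_smult)
  then have "c * c = 1" by (simp only: of_real_eq_1_iff)
  moreover have "c \<ge> 0"
  proof -
    have "complex_of_real (poly (P k) 1) = poly (cpoly (P k)) 1" for k
      using poly_cpoly_of_real[of "P k" 1] by simp
    moreover have "complex_of_real (poly p 1) = poly (cpoly p) 1"
      using poly_cpoly_of_real[of p 1] by simp
    ultimately have "(\<lambda>k. complex_of_real (poly (P k) 1)) \<longlonglongrightarrow> of_real (poly p 1)" using plim[of 1] by simp
    then have "(\<lambda>k. poly (P k) 1) \<longlonglongrightarrow> poly p 1" by (simp only: tendsto_of_real_iff)
    then have "poly p 1 \<ge> 0"
      by (rule LIMSEQ_le_const) (use P in \<open>auto simp: spectral_factor_def intro: less_imp_le\<close>)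
    then show ?thesis using q1 by (simp add: c zero_le_mult_iff)
  qed
  ultimately have "c = 1" by (simp add: square_eq_1_iff)
  then show ?thesis by (simp add: c)
qed

lemma fps_of_poly_linear_factor: "fps_of_poly [:1, e:] = lin (- e)"
  by (rule fps_ext) (auto simp: lin_def coeff_pCons split: nat.splits)

text \<open>The whole masks have coefficients of size at most 2, and \<open>Q k\<close> arises from
  them on dividing by the exponential factors as power series. Only coefficients below
  \<open>n\<close> count, so truncated geometric series with nodes at most exp |\<Lambda> j| bound
  the inverses uniformly in \<open>k\<close>.\<close>

lemma spectral_factors_bounded:
  assumes "n \<ge> 1" "\<And>k. spectral_factor n (\<lambda>j. \<Lambda> j / 2 ^ k) (Q k)"
  shows "\<exists>B. \<forall>k i. \<bar>coeff (Q k) i\<bar> \<le> B"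
proof -
  define B where "B = 2 * real n * (\<Prod>j<n. \<Sum>i<n. exp \<bar>\<Lambda> j\<bar> ^ i)"
  have "\<bar>coeff (Q k) i\<bar> \<le> B" for k i
  proof (cases "i < n")
    case True
    define e where "e j = exp (\<Lambda> j / 2 ^ k)" for j
    define a where "a = Q k * (\<Prod>j<n. [:1, e j:])"
    have e: "0 < e j" "e j \<le> exp \<bar>\<Lambda> j\<bar>" for j
    proof -
      have "\<Lambda> j / 2 ^ k \<le> \<bar>\<Lambda> j\<bar> / 2 ^ k" by (intro divide_right_mono) auto
      also have "\<dots> \<le> \<bar>\<Lambda> j\<bar>" by (simp add: divide_le_eq mult_le_cancel_left1)
      finally show "e j \<le> exp \<bar>\<Lambda> j\<bar>" by (simp add: e_def)
    qed (simp add: e_def)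
    have "fps_of_poly a * (\<Prod>j<n. inverse (lin (- e j))) =
        fps_of_poly (Q k) * (\<Prod>j<n. lin (- e j) * inverse (lin (- e j)))"
      by (simp only: a_def fps_of_poly_mult fps_of_poly_prod fps_of_poly_linear_factor prod.distrib mult.assoc)
    then have fac: "fps_of_poly (Q k) = fps_of_poly a * (\<Prod>j<n. inverse (lin (- e j)))" by simp
    have "norm (fps_of_poly (Q k) $ i) \<le> l1_upto n (fps_of_poly (Q k))"
      unfolding l1_upto_def using True by (intro member_le_sum) auto
    also have "\<dots> \<le> l1_upto n (fps_of_poly a) * (\<Prod>j<n. l1_upto n (inverse (lin (- e j))))"
      unfolding fac by (rule order_trans[OF l1_upto_mult mult_left_mono[OF l1_upto_prod]]) simp
    also have "\<dots> \<le> (2 * real n) * (\<Prod>j<n. \<Sum>i<n. exp \<bar>\<Lambda> j\<bar> ^ i)"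
    proof (intro mult_mono prod_mono conjI)
      have "l1_upto n (fps_of_poly a) \<le> (\<Sum>i<n. 2)"
        unfolding l1_upto_def
        using spectral_factor_bounded_coeffs[OF assms(1) assms(2)[of k]]
        by (intro sum_mono) (simp add: a_def e_def)
      then show "l1_upto n (fps_of_poly a) \<le> 2 * real n" by simp
      show "l1_upto n (inverse (lin (- e j))) \<le> (\<Sum>i<n. exp \<bar>\<Lambda> j\<bar> ^ i)" for j
        unfolding l1_upto_def inverse_lin using e[of j]
        by (intro sum_mono) (simp add: power_abs[symmetric] norm_power power_mono)
    qed (auto intro: prod_nonneg)
    finally show ?thesis by (simp add: B_def)
  next
    case False
    then have "coeff (Q k) i = 0" using assms by (intro coeff_eq_0) (auto simp: spectral_factor_def)
    then show ?thesis by (simp add: B_def prod_nonneg sum_nonneg)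
  qed
  then show ?thesis by blast
qed

section \<open>The linearized factorization and the rate of convergence\<close>

text \<open>With * for the reciprocal, injectivity of the symmetrization gives u q* + q u* = 0. So
  \<open>q\<close> divides u q*, whence u = c q, and 2 c q q* = 0 forces c = 0.\<close>

lemma linearized_factorization_injective:
  assumes n: "n \<ge> 1" and q: "spectral_factor n (\<lambda>_. 0) q" and deg: "degree u \<le> n - 1"
    and eq: "\<And>z. z \<noteq> 0 \<Longrightarrow>
      (poly (cpoly u) z * poly (cpoly q) (1 / z) + poly (cpoly q) z * poly (cpoly u) (1 / z)) * sym_exp_factor n (\<lambda>_. 1) z +
      (poly (cpoly u) (- z) * poly (cpoly q) (1 / - z) + poly (cpoly q) (- z) * poly (cpoly u) (1 / - z)) * sym_exp_factor n (\<lambda>_. 1) (- z) = 0"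
  shows "u = 0"
proof -
  let ?rev = "\<lambda>r. rev_poly (n - 1) (cpoly r)"
  have degq: "degree q = n - 1" and q0: "q \<noteq> 0"
    and out: "\<And>z. poly (cpoly q) z = 0 \<Longrightarrow> cmod z \<ge> 1"
    using q by (auto simp: spectral_factor_def)
  have S: "cpoly u * ?rev q + cpoly q * ?rev u = 0"
  proof (rule symmetrized_product_injective[OF n _ _ eq])
    show "degree (cpoly u * ?rev q + cpoly q * ?rev u) \<le> 2 * (n - 1)"
      using deg degq by (intro degree_add_le degree_mult_rev_poly_le) auto
    show "poly (cpoly u * ?rev q + cpoly q * ?rev u) z =
        z ^ (n - 1) * (poly (cpoly u) z * poly (cpoly q) (1 / z) + poly (cpoly q) z * poly (cpoly u) (1 / z))"
      if "z \<noteq> 0" for z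
      using that deg degq by (simp add: poly_rev_poly distrib_left)
  qed
  then have "cpoly u * ?rev q = cpoly q * (- ?rev u)" by (simp add: add_eq_0_iff2)
  then have "cpoly q dvd cpoly u * ?rev q" by simp
  then have "\<exists>c. u = smult c q"
    using degq by (intro multiple_of_classical_factor[OF n q deg _ out]) auto
  then obtain c where c: "u = smult c q" by blast
  have "cpoly u = smult (of_real c) (cpoly q)" by (intro poly_eqI) (simp add: c)
  moreover have "?rev u = smult (of_real c) (?rev q)" by (intro poly_eqI) (simp add: c coeff_rev_poly)
  ultimately have "smult (2 * of_real c) (cpoly q * ?rev q) = 0" using S by (simp add: smult_add_left[symmetric])
  moreover have "cpoly q * ?rev q \<noteq> 0"
  proof -
    have "coeff (?rev q) 0 \<noteq> 0" using q0 degq by (simp add: coeff_rev_poly) (metis leading_coeff_0_iff)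
    then have "?rev q \<noteq> 0" by auto
    moreover have "cpoly q \<noteq> 0" using q0 by (simp add: map_poly_eq_0_iff)
    ultimately show ?thesis by simp
  qed
  ultimately have "c = 0" by simp
  then show ?thesis by (simp add: c)
qed

text \<open>Otherwise the normalized differences \<open>(Q k - q) / \<parallel>Q k - q\<parallel>\<close> would accumulate at a nonzero
  element of the kernel of the linearized factorization.\<close>

lemma spectral_factor_rate:
  assumes n: "n \<ge> 1" and q: "spectral_factor n (\<lambda>_. 0) q"
    and Q: "\<And>k. spectral_factor n (\<lambda>j. \<Lambda> j / 2 ^ k) (Q k)"
  shows "\<exists>C. \<forall>k. (\<Sum>i<n. \<bar>coeff (Q k - q) i\<bar>) \<le> C / 2 ^ k"
proof (rule ccontr)
  assume neg: "\<not> ?thesis"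
  define L where "L k = (\<Sum>i<n. \<bar>coeff (Q k - q) i\<bar>)" for k
  have degQ: "degree (Q k) \<le> n - 1" for k using Q by (simp add: spectral_factor_def)
  have degq: "degree q \<le> n - 1" using q by (simp add: spectral_factor_def)
  obtain B where B: "\<And>k i. \<bar>coeff (Q k) i\<bar> \<le> B" using spectral_factors_bounded[OF n Q] by blast
  have LB: "L k \<le> (\<Sum>i<n. B + \<bar>coeff q i\<bar>)" for k
    unfolding L_def using B[of k] by (intro sum_mono) (auto intro: order_trans[OF abs_triangle_ineq4])
  define B' where "B' = (\<Sum>i<n. B + \<bar>coeff q i\<bar>)"
  have "\<forall>m. \<exists>k. real (Suc m) / 2 ^ k < L k" using neg unfolding L_def by (meson not_le)
  \<comment> \<open>\<open>\<kappa> m\<close> is a level at which the constant \<open>Suc m\<close>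
    fails. These levels need not increase; that \<open>t\<close> tends to 0 follows from the
    boundedness of \<open>L\<close>.\<close>
  then obtain \<kappa> where \<kappa>: "\<And>m. real (Suc m) / 2 ^ \<kappa> m < L (\<kappa> m)" by metis
  define t where "t m = 1 / (2::real) ^ \<kappa> m" for m
  have tpos: "t m > 0" for m by (simp add: t_def)
  have \<kappa>': "real (Suc m) * t m < L (\<kappa> m)" for m using \<kappa>[of m] by (simp add: t_def)
  have Lpos: "L (\<kappa> m) > 0" for m
  proof -
    have "0 < real (Suc m) * t m" using tpos by simp
    then show ?thesis using \<kappa>'[of m] by linarith
  qed
  have inv: "(\<lambda>m. c / real (Suc m)) \<longlonglongrightarrow> 0" for c :: real
    using tendsto_mult_right_zero[OF LIMSEQ_inverse_real_of_nat, of c] by (simp add: divide_inverse)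
  have t0: "t \<longlonglongrightarrow> 0"
  proof (rule tendsto_sandwich[OF _ _ tendsto_const inv[of B']])
    have "t m \<le> B' / real (Suc m)" for m
      using \<kappa>'[of m] LB[of "\<kappa> m"] by (simp add: le_divide_eq B'_def mult.commute)
    then show "\<forall>\<^sub>F m in sequentially. t m \<le> B' / real (Suc m)" by simp
  qed (simp add: tpos less_imp_le)
  have tL0: "(\<lambda>m. t m / L (\<kappa> m)) \<longlonglongrightarrow> 0"
  proof (rule tendsto_sandwich[OF _ _ tendsto_const inv[of 1]])
    have "t m / L (\<kappa> m) \<le> 1 / real (Suc m)" for m
      using \<kappa>'[of m] Lpos[of m] by (simp add: field_simps)
    then show "\<forall>\<^sub>F m in sequentially. t m / L (\<kappa> m) \<le> 1 / real (Suc m)" by simp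
  qed (simp add: tpos Lpos less_imp_le)
  define P where "P m = Q (\<kappa> m)" for m
  define U where "U m = smult (1 / L (\<kappa> m)) (P m - q)" for m
  have sf: "spectral_factor n (\<lambda>j. \<Lambda> j * t m) (P m)" for m using Q[of "\<kappa> m"] by (simp add: P_def t_def)
  have degU: "degree (U m) \<le> n - 1" for m
    unfolding U_def using degQ degq by (intro order_trans[OF degree_smult_le] degree_diff_le) (auto simp: P_def)
  have sumU: "(\<Sum>i<n. \<bar>coeff (U m) i\<bar>) = 1" for m
    using Lpos[of m] by (simp add: U_def P_def abs_mult sum_divide_distrib[symmetric] abs_divide L_def[symmetric] flip: coeff_diff)
  have U1: "\<bar>coeff (U m) i\<bar> \<le> 1" for m i
  proof (cases "i < n")
    case True
    then have "\<bar>coeff (U m) i\<bar> \<le> (\<Sum>i<n. \<bar>coeff (U m) i\<bar>)" by (intro member_le_sum) auto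
    then show ?thesis by (simp add: sumU)
  next
    case False
    then show ?thesis using degU[of m] n by (simp add: coeff_eq_0)
  qed
  obtain p r1 where r1: "strict_mono r1" "degree p \<le> n - 1" "\<And>i. (\<lambda>k. coeff (P (r1 k)) i) \<longlonglongrightarrow> coeff p i"
    by (rule bounded_poly_convergent_subsequence[of P B "n - 1"]) (use B degQ in \<open>auto simp: P_def\<close>)
  have "p = q"
  proof (rule spectral_factor_limit[OF n q _ _ r1(3,2)])
    show "spectral_factor n (\<lambda>j. \<Lambda> j * (t \<circ> r1) k) (P (r1 k))" for k using sf by simp
    show "(t \<circ> r1) \<longlonglongrightarrow> 0" by (rule LIMSEQ_subseq_LIMSEQ[OF t0 r1(1)])
  qed
  obtain u r2 where r2: "strict_mono r2" "degree u \<le> n - 1" "\<And>i. (\<lambda>k. coeff (U (r1 (r2 k))) i) \<longlonglongrightarrow> coeff u i"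
    by (rule bounded_poly_convergent_subsequence[of "\<lambda>k. U (r1 k)" 1 "n - 1"]) (use U1 degU in auto)
  define r where "r = r1 \<circ> r2"
  have r: "strict_mono r" using r1(1) r2(1) by (simp add: r_def strict_mono_o)
  have limP: "(\<lambda>k. poly (cpoly (P (r k))) z) \<longlonglongrightarrow> poly (cpoly q) z" for z
    using LIMSEQ_subseq_LIMSEQ[OF r1(3) r2(1)] degQ degq
    by (intro tendsto_poly_cpoly[of _ _ "n - 1"]) (auto simp: \<open>p = q\<close> r_def o_def P_def)
  have limU: "(\<lambda>k. poly (cpoly (U (r k))) z) \<longlonglongrightarrow> poly (cpoly u) z" for z
    using r2 degU by (intro tendsto_poly_cpoly[of _ _ "n - 1"]) (auto simp: r_def)
  define E where "E m = sym_exp_factor n (\<lambda>j. of_real (exp (\<Lambda> j * t m)))" for m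
  define E0 where "E0 = sym_exp_factor n (\<lambda>_. 1)"
  have quot: "(\<lambda>m. (E m z - E0 z) / of_real (L (\<kappa> m))) \<longlonglongrightarrow> 0" and limE: "(\<lambda>m. E m z) \<longlonglongrightarrow> E0 z" if z: "z \<noteq> 0" for z
  proof -
    define F where "F = (\<lambda>s. sym_exp_factor n (\<lambda>j. exp (of_real (\<Lambda> j) * s)) z)"
    obtain D where D: "(F has_field_derivative D) (at 0)"
      using sym_exp_factor_derivative[OF z, of n "\<lambda>j. of_real (\<Lambda> j)"] by (auto simp: F_def)
    have F: "E m z = F (of_real (t m))" "E0 z = F 0" for m
      by (simp_all add: E_def E0_def F_def exp_of_real flip: of_real_mult)
    have t0': "(\<lambda>m. complex_of_real (t m)) \<longlonglongrightarrow> 0" using tendsto_of_real[OF t0] by simp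
    then have "filterlim (\<lambda>m. complex_of_real (t m)) (at 0) sequentially"
      unfolding filterlim_at by (simp add: tpos less_imp_neq[symmetric])
    then have "(\<lambda>m. (F (of_real (t m)) - F 0) / of_real (t m)) \<longlonglongrightarrow> D"
      using D unfolding has_field_derivative_iff by (auto intro: filterlim_compose)
    \<comment> \<open>The variation of E is O(t), and t / L tends to 0, so it is negligible against
      \<open>L\<close>.\<close>
    then have "(\<lambda>m. (F (of_real (t m)) - F 0) / of_real (t m) * of_real (t m / L (\<kappa> m))) \<longlonglongrightarrow> D * of_real 0"
      by (intro tendsto_mult tendsto_of_real tL0)
    then show "(\<lambda>m. (E m z - E0 z) / of_real (L (\<kappa> m))) \<longlonglongrightarrow> 0"
      using tpos by (simp add: F less_imp_neq[symmetric])
    have "isCont F 0" using D DERIV_isCont by blast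
    then show "(\<lambda>m. E m z) \<longlonglongrightarrow> E0 z"
      unfolding F using t0' by (rule isCont_tendsto_compose)
  qed
  \<comment> \<open>With P = q + L U, using P in one factor of \<open>N\<close> absorbs the
    quadratic term: P(z) P(1/z) = q(z) q(1/z) + L N(z) exactly.\<close>
  define N where "N m z = poly (cpoly (U m)) z * poly (cpoly (P m)) (1 / z) + poly (cpoly q) z * poly (cpoly (U m)) (1 / z)" for m z
  have lin: "N m z * E m z + N m (- z) * E m (- z) =
      - (poly (cpoly q) z * poly (cpoly q) (1 / z) * ((E m z - E0 z) / of_real (L (\<kappa> m))) +
         poly (cpoly q) (- z) * poly (cpoly q) (1 / - z) * ((E m (- z) - E0 (- z)) / of_real (L (\<kappa> m))))"
    if "z \<noteq> 0" for m z
  proof -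
    define l where "l = complex_of_real (L (\<kappa> m))"
    have l: "l \<noteq> 0" using Lpos[of m] by (simp add: l_def)
    have P: "poly (cpoly (P m)) w = poly (cpoly q) w + l * poly (cpoly (U m)) w" for w
    proof -
      have "P m = q + smult (L (\<kappa> m)) (U m)" using Lpos[of m] by (simp add: U_def)
      then have "cpoly (P m) = cpoly q + smult l (cpoly (U m))" by (intro poly_eqI) (simp add: l_def)
      then show ?thesis by simp
    qed
    have PP: "poly (cpoly (P m)) w * poly (cpoly (P m)) (1 / w) =
        poly (cpoly q) w * poly (cpoly q) (1 / w) + l * N m w" for w
      unfolding N_def P by (simp add: algebra_simps)
    have "poly (cpoly (P m)) z * poly (cpoly (P m)) (1 / z) * E m z +
        poly (cpoly (P m)) (- z) * poly (cpoly (P m)) (1 / - z) * E m (- z) = 4"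
      using sf[of m] that by (simp add: spectral_factor_def E_def)
    moreover have "poly (cpoly q) z * poly (cpoly q) (1 / z) * E0 z +
        poly (cpoly q) (- z) * poly (cpoly q) (1 / - z) * E0 (- z) = 4"
      using q that by (simp add: spectral_factor_def E0_def)
    ultimately have "l * (N m z * E m z + N m (- z) * E m (- z)) =
        - (poly (cpoly q) z * poly (cpoly q) (1 / z) * (E m z - E0 z) +
           poly (cpoly q) (- z) * poly (cpoly q) (1 / - z) * (E m (- z) - E0 (- z)))"
      unfolding PP by (simp add: algebra_simps)
    moreover have "A = - (b * (x / l) + c * (y / l))" if "l * A = - (b * x + c * y)" for A b c x y
    proof -
      have "A = (l * A) / l" using l by simp
      then show ?thesis unfolding that by (simp add: add_divide_distrib diff_divide_distrib)
    qed
    ultimately show ?thesis unfolding l_def[symmetric] by blast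
  qed
  have "u = 0"
  proof (rule linearized_factorization_injective[OF n q r2(2)], fold E0_def)
    fix z :: complex assume z: "z \<noteq> 0"
    have limN: "(\<lambda>k. N (r k) w) \<longlonglongrightarrow> poly (cpoly u) w * poly (cpoly q) (1 / w) + poly (cpoly q) w * poly (cpoly u) (1 / w)" for w
      unfolding N_def by (intro tendsto_intros limU limP)
    have sub: "(\<lambda>k. f (r k)) \<longlonglongrightarrow> c" if "f \<longlonglongrightarrow> c" for f :: "nat \<Rightarrow> complex" and c
      using LIMSEQ_subseq_LIMSEQ[OF that r] by (simp add: o_def)
    have "(\<lambda>k. N (r k) z * E (r k) z + N (r k) (- z) * E (r k) (- z)) \<longlonglongrightarrow>
        - (poly (cpoly q) z * poly (cpoly q) (1 / z) * 0 + poly (cpoly q) (- z) * poly (cpoly q) (1 / - z) * 0)"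
      unfolding lin[OF z] using z by (intro tendsto_intros sub quot) auto
    moreover have "(\<lambda>k. N (r k) z * E (r k) z + N (r k) (- z) * E (r k) (- z)) \<longlonglongrightarrow>
      (poly (cpoly u) z * poly (cpoly q) (1 / z) + poly (cpoly q) z * poly (cpoly u) (1 / z)) * E0 z +
      (poly (cpoly u) (- z) * poly (cpoly q) (1 / - z) + poly (cpoly q) (- z) * poly (cpoly u) (1 / - z)) * E0 (- z)"
      using z by (intro tendsto_intros limN sub limE) auto
    ultimately show "(poly (cpoly u) z * poly (cpoly q) (1 / z) + poly (cpoly q) z * poly (cpoly u) (1 / z)) * E0 z +
      (poly (cpoly u) (- z) * poly (cpoly q) (1 / - z) + poly (cpoly q) (- z) * poly (cpoly u) (1 / - z)) * E0 (- z) = 0"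
      using LIMSEQ_unique by fastforce
  qed
  moreover have "(\<Sum>i<n. \<bar>coeff u i\<bar>) = 1"
  proof (rule LIMSEQ_unique)
    show "(\<lambda>k. \<Sum>i<n. \<bar>coeff (U (r k)) i\<bar>) \<longlonglongrightarrow> (\<Sum>i<n. \<bar>coeff u i\<bar>)"
      using r2(3) by (intro tendsto_intros) (simp add: r_def)
    show "(\<lambda>k. \<Sum>i<n. \<bar>coeff (U (r k)) i\<bar>) \<longlonglongrightarrow> 1" by (simp add: sumU)
  qed
  ultimately show False by simp
qed

section \<open>Ratios of spectral factors\<close>

lemma l1_inverse_linear:
  fixes z :: complex
  assumes "cmod z > 1"
  shows "l1_upto N (inverse (fps_of_poly [:- z, 1:])) \<le> cmod (1 / z) * (1 / (1 - cmod (1 / z)))"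
proof -
  have "z \<noteq> 0" and lt: "cmod (1 / z) < 1" using assms by (auto simp: norm_divide divide_less_eq)
  have "fps_of_poly [:- z, 1:] * Abs_fps (\<lambda>i. - ((1 / z) ^ Suc i)) = 1"
  proof (rule fps_ext)
    fix i
    have lin: "fps_of_poly [:- z, 1:] = fps_X - fps_const z" by (rule fps_ext) (auto simp: coeff_pCons split: nat.splits)
    show "(fps_of_poly [:- z, 1:] * Abs_fps (\<lambda>i. - ((1 / z) ^ Suc i))) $ i = 1 $ i"
      unfolding lin using \<open>z \<noteq> 0\<close> by (cases i) (auto simp: left_diff_distrib)
  qed
  then have "inverse (fps_of_poly [:- z, 1:]) = Abs_fps (\<lambda>i. - ((1 / z) ^ Suc i))"
    by (rule fps_inverse_unique)
  then have "l1_upto N (inverse (fps_of_poly [:- z, 1:])) = cmod (1 / z) * (\<Sum>i<N. cmod (1 / z) ^ i)"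
    by (simp add: l1_upto_def norm_mult norm_power sum_distrib_left norm_divide power_divide sum_divide_distrib)
  also have "\<dots> \<le> cmod (1 / z) * (\<Sum>i. cmod (1 / z) ^ i)"
    using lt by (intro mult_left_mono sum_le_suminf summable_geometric) auto
  also have "(\<Sum>i. cmod (1 / z) ^ i) = 1 / (1 - cmod (1 / z))"
    using lt by (intro suminf_geometric) auto
  finally show ?thesis .
qed

text \<open>Each linear factor is inverted by a convergent geometric series. Strictness matters: 1 /
  (1 - y) has unbounded truncated norms.\<close>

lemma l1_inverse_of_roots_outside:
  fixes p :: "complex poly"
  assumes "p \<noteq> 0" "\<And>z. poly p z = 0 \<Longrightarrow> cmod z > 1"
  shows "\<exists>K. \<forall>N. l1_upto N (inverse (fps_of_poly p)) \<le> K"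
  using assms
proof (induction "degree p" arbitrary: p)
  case 0
  then obtain c where c: "p = [:c:]" "c \<noteq> 0" by (metis degree_eq_zeroE pCons_0_0)
  have "l1_upto N (inverse (fps_of_poly p)) \<le> cmod (1 / c)" for N
    by (cases N) (simp_all add: c fps_of_poly_const fps_const_inverse l1_upto_def sum.lessThan_Suc_shift divide_inverse del: sum.lessThan_Suc)
  then show ?case by blast
next
  case (Suc k)
  then have "\<not> constant (poly p)" by (simp add: constant_degree)
  then obtain z where z: "poly p z = 0" using fundamental_theorem_of_algebra by blast
  then obtain p1 where p1: "p = [:- z, 1:] * p1" by (metis dvdE poly_eq_0_iff_dvd)
  have p10: "p1 \<noteq> 0" using Suc.prems(1) p1 by auto
  have "degree p = Suc (degree p1)"
    unfolding p1 using p10 by (subst degree_mult_eq) auto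
  then have deg: "degree p1 = k" using Suc.hyps(2) by simp
  obtain K where K: "\<And>N. l1_upto N (inverse (fps_of_poly p1)) \<le> K"
    using Suc.hyps(1)[of p1] p10 deg Suc.prems(2) by (auto simp: p1)
  have z1: "cmod z > 1" using Suc.prems(2) z by blast
  then have "cmod (1 / z) * (1 / (1 - cmod (1 / z))) \<ge> 0" by (simp add: norm_divide divide_le_eq)
  then have "l1_upto N (inverse (fps_of_poly p)) \<le> cmod (1 / z) * (1 / (1 - cmod (1 / z))) * K" for N
    unfolding p1 fps_of_poly_mult fps_inverse_mult
    by (intro order_trans[OF l1_upto_mult] mult_mono l1_inverse_linear[OF z1] K) simp_all
  then show ?case by blast
qed

text \<open>The real inverse series, read over the complex numbers, is the complex inverse, so the
  bound obtained from the roots carries over.\<close>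

lemma classical_inverse_l1:
  assumes "n \<ge> 1" "spectral_factor n (\<lambda>_. 0) q"
  shows "\<exists>K. \<forall>N. l1_upto N (inverse (fps_of_poly q)) \<le> K"
proof -
  have roots: "cmod z > 1" if "poly (cpoly q) z = 0" for z
    using classical_spectral_factor_roots[OF assms that] .
  have "cpoly q \<noteq> 0" using assms(2) by (auto simp: spectral_factor_def map_poly_eq_0_iff)
  then obtain K where K: "\<And>N. l1_upto N (inverse (fps_of_poly (cpoly q))) \<le> K"
    using l1_inverse_of_roots_outside roots by blast
  have "poly (cpoly q) 0 \<noteq> 0" using roots[of 0] by auto
  then have q0: "fps_of_poly q $ 0 \<noteq> 0" by (simp add: poly_0_coeff_0)
  have eq: "inverse (fps_of_poly (cpoly q)) = Abs_fps (\<lambda>i. of_real (inverse (fps_of_poly q) $ i))"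
  proof (rule fps_inverse_unique, rule fps_ext)
    fix i
    have "(fps_of_poly (cpoly q) * Abs_fps (\<lambda>i. of_real (inverse (fps_of_poly q) $ i))) $ i =
        complex_of_real ((fps_of_poly q * inverse (fps_of_poly q)) $ i)"
      by (simp add: fps_mult_nth)
    also have "\<dots> = 1 $ i" using q0 by (simp add: inverse_mult_eq_1')
    finally show "(fps_of_poly (cpoly q) * Abs_fps (\<lambda>i. of_real (inverse (fps_of_poly q) $ i))) $ i = 1 $ i" .
  qed
  have "l1_upto N (inverse (fps_of_poly q)) \<le> K" for N
    using K[of N] by (simp add: l1_upto_def eq)
  then show ?thesis by blast
qed

lemma spectral_factor_ratios_near_1:
  assumes n: "n \<ge> 1" and q: "spectral_factor n (\<lambda>_. 0) q"
    and Q: "\<And>k. spectral_factor n (\<lambda>j. \<Lambda> j / 2 ^ k) (Q k)"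
  obtains \<epsilon> :: "nat \<Rightarrow> real" and I where "summable \<epsilon>" "\<And>k. \<epsilon> k \<ge> 0"
    "\<And>N k. k \<ge> I \<Longrightarrow> l1_upto N (fps_of_poly (Q k) * inverse (fps_of_poly q)) \<le> 1 + \<epsilon> k"
    "\<And>N k. k \<ge> I \<Longrightarrow> l1_upto N (fps_of_poly q * inverse (fps_of_poly (Q k))) \<le> 1 + \<epsilon> k"
proof -
  have nz: "fps_of_poly r $ 0 \<noteq> 0" if "spectral_factor n \<mu> r" for \<mu> r
  proof -
    have "poly (cpoly r) 0 \<noteq> 0" using that by (force simp: spectral_factor_def)
    then show ?thesis by (simp add: poly_0_coeff_0)
  qed
  obtain C where C: "\<And>k. (\<Sum>i<n. \<bar>coeff (Q k - q) i\<bar>) \<le> C / 2 ^ k"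
    using spectral_factor_rate[OF assms] by blast
  obtain K where K: "\<And>N. l1_upto N (inverse (fps_of_poly q)) \<le> K"
    using classical_inverse_l1[OF n q] by blast
  have "0 \<le> K" using K[of 0] by (simp add: l1_upto_def)
  have "0 \<le> (\<Sum>i<n. \<bar>coeff (Q 0 - q) i\<bar>)" by (rule sum_nonneg) simp
  then have "0 \<le> C" using order_trans[OF _ C[of 0]] by simp
  define s where "s k = (fps_of_poly (Q k) - fps_of_poly q) * inverse (fps_of_poly q)" for k
  \<comment> \<open>Twice the bound C K / 2^k for \<open>s k\<close>; the slack is spent on the
    inverse quotient.\<close>
  define \<epsilon> where "\<epsilon> k = 2 * (C * K) * (1 / 2) ^ k" for k
  have eps0: "\<epsilon> k \<ge> 0" for k using \<open>0 \<le> K\<close> \<open>0 \<le> C\<close> by (simp add: \<epsilon>_def)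
  have s: "l1_upto N (s k) \<le> \<epsilon> k / 2" for N k
  proof -
    have "l1_upto N (fps_of_poly (Q k) - fps_of_poly q) \<le> (\<Sum>i<n. \<bar>coeff (Q k - q) i\<bar>)"
    proof -
      have "coeff (Q k - q) i = 0" if "i \<ge> n" for i
      proof (rule coeff_eq_0)
        have "degree (Q k - q) \<le> n - 1"
          using q Q[of k] by (intro degree_diff_le) (auto simp: spectral_factor_def)
        then show "degree (Q k - q) < i" using that n by simp
      qed
      then have "l1_upto N (fps_of_poly (Q k) - fps_of_poly q) = (\<Sum>i\<in>{..<N} \<inter> {..<n}. \<bar>coeff (Q k - q) i\<bar>)"
        unfolding l1_upto_def by (intro sum.mono_neutral_cong_right) (auto simp flip: not_le)
      also have "\<dots> \<le> (\<Sum>i<n. \<bar>coeff (Q k - q) i\<bar>)" by (rule sum_mono2) auto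
      finally show ?thesis .
    qed
    then have "l1_upto N (fps_of_poly (Q k) - fps_of_poly q) \<le> C / 2 ^ k" using C[of k] by linarith
    then have "l1_upto N (s k) \<le> C / 2 ^ k * K"
      unfolding s_def using \<open>0 \<le> C\<close> by (intro order_trans[OF l1_upto_mult] mult_mono K) auto
    then show ?thesis by (simp add: \<epsilon>_def power_one_over field_simps)
  qed
  have Qs: "fps_of_poly (Q k) * inverse (fps_of_poly q) = 1 + s k" for k
    using nz[OF q] by (simp add: s_def left_diff_distrib inverse_mult_eq_1')
  have "summable \<epsilon>" unfolding \<epsilon>_def by (intro summable_mult summable_geometric) simp
  then have "\<epsilon> \<longlonglongrightarrow> 0" by (rule summable_LIMSEQ_zero)
  then obtain I where I: "\<And>k. k \<ge> I \<Longrightarrow> \<epsilon> k < 1"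
    using order_tendstoD(2)[of \<epsilon> 0 sequentially 1] by (auto simp: eventually_sequentially)
  show thesis
  proof (rule that[of \<epsilon> I])
    fix N k :: nat assume k: "k \<ge> I"
    have "l1_upto N (1 + s k) \<le> 1 + \<epsilon> k / 2"
      using l1_upto_add[of N 1 "s k"] l1_upto_1[where 'a = real, of N] s[of N k] by linarith
    then show "l1_upto N (fps_of_poly (Q k) * inverse (fps_of_poly q)) \<le> 1 + \<epsilon> k"
      unfolding Qs using eps0[of k] by linarith
    define x where "x = fps_of_poly q * inverse (fps_of_poly (Q k))"
    have "x * (fps_of_poly (Q k) * inverse (fps_of_poly q)) =
        (fps_of_poly q * inverse (fps_of_poly q)) * (fps_of_poly (Q k) * inverse (fps_of_poly (Q k)))"
      by (simp add: x_def mult_ac)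
    then have "x * (1 + s k) = 1" using nz[OF q] nz[OF Q] by (simp add: Qs inverse_mult_eq_1')
    \<comment> \<open>This fixed-point form replaces a Neumann series: truncated norms are finite,
      so the norm of \<open>x\<close> can be moved to the left. The resulting bound 1 / (1 -
      \<epsilon>/2) is at most 1 + \<epsilon> because \<epsilon> < 1.\<close>
    then have "x = 1 + - (s k * x)" by (simp add: algebra_simps eq_diff_eq)
    then have "l1_upto N x = l1_upto N (1 + - (s k * x))" by (rule arg_cong)
    also have "\<dots> \<le> l1_upto N (1 :: real fps) + l1_upto N (s k * x)"
      using l1_upto_add[of N 1 "- (s k * x)"] by simp
    also have "\<dots> \<le> 1 + \<epsilon> k / 2 * l1_upto N x"
      by (intro add_mono l1_upto_1 order_trans[OF l1_upto_mult] mult_right_mono s) simp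
    finally have "l1_upto N x * (1 - \<epsilon> k / 2) \<le> 1" by (simp add: algebra_simps)
    also have "1 \<le> (1 + \<epsilon> k) * (1 - \<epsilon> k / 2)"
    proof -
      have "\<epsilon> k * \<epsilon> k \<le> \<epsilon> k * 1" using I[OF k] eps0[of k] by (intro mult_left_mono) auto
      then show ?thesis by (simp add: algebra_simps)
    qed
    finally show "l1_upto N (fps_of_poly q * inverse (fps_of_poly (Q k))) \<le> 1 + \<epsilon> k"
      unfolding x_def[symmetric] using I[OF k] by (subst (asm) mult_le_cancel_right_pos) auto
  qed (use eps0 \<open>summable \<epsilon>\<close> in auto)
qed

definition mask_fps :: "(int \<Rightarrow> real) \<Rightarrow> real fps" where
  "mask_fps a = Abs_fps (\<lambda>i. a (int i))"

text \<open>Passes from identities between complex symbols to real power series. The top mask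
  coefficient is recorded as nonzero because it is the constant coefficient of
  \<open>wavelet_fps\<close>, which makes that series invertible.\<close>

lemma daubechies_mask_factorization:
  assumes n: "n \<ge> 1" and mask: "is_daubechies_mask n \<mu> a"
  obtains q where "spectral_factor n \<mu> q"
    "mask_fps a = fps_of_poly q * (\<Prod>j<n. 1 + fps_const (exp (\<mu> j)) * fps_X)"
    "a (2 * int n - 1) \<noteq> 0" "{\<alpha>. a \<alpha> \<noteq> 0} \<subseteq> {0..2 * int n - 1}"
proof -
  have supp: "0 \<le> \<alpha> \<and> \<alpha> \<le> 2 * int n - 1" if "a \<alpha> \<noteq> 0" for \<alpha>
    using mask that by (auto simp: is_daubechies_mask_def)
  obtain d q where d: "is_interpolatory_symbol n \<mu> d"
    and q: "degree q = n - 1" "poly q 1 > 0" "\<And>z. poly (cpoly q) z = 0 \<Longrightarrow> cmod z \<ge> 1"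
    and fac: "\<And>z. symbol a z = poly (cpoly q) z * (\<Prod>j<n. 1 + of_real (exp (\<mu> j)) * z)"
    and ad: "\<And>z. z \<noteq> 0 \<Longrightarrow> symbol a z * symbol a (1 / z) / 2 = symbol d z"
    using mask unfolding is_daubechies_mask_def by blast
  define M where "M = 2 * n - 1"
  have M: "int M = 2 * int n - 1" using n by (simp add: M_def)
  define p where "p = (\<Sum>i\<le>M. monom (a (int i)) i)"
  have p: "coeff p i = a (int i)" for i
  proof -
    have "coeff p i = (\<Sum>j\<le>M. if j = i then a (int j) else 0)"
      unfolding p_def coeff_sum by (rule sum.cong) auto
    also have "\<dots> = (if i \<le> M then a (int i) else 0)" by simp
    also have "\<dots> = a (int i)"
    proof (cases "i \<le> M")
      case False
      then have "\<not> int i \<le> 2 * int n - 1" using M by linarith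
      then show ?thesis using supp[of "int i"] False by auto
    qed simp
    finally show ?thesis .
  qed
  have degp: "degree p \<le> M" by (rule degree_le) (use supp M in \<open>fastforce simp: p\<close>)
  have "poly (cpoly p) z = symbol a z" for z
  proof -
    have "symbol a z = (\<Sum>\<alpha>\<in>int ` {..M}. of_real (a \<alpha>) * z powi \<alpha>)"
      unfolding symbol_def
    proof (rule sum.mono_neutral_left)
      show "{\<alpha>. a \<alpha> \<noteq> 0} \<subseteq> int ` {..M}"
      proof
        fix \<alpha> assume "\<alpha> \<in> {\<alpha>. a \<alpha> \<noteq> 0}"
        then have "\<alpha> = int (nat \<alpha>)" "nat \<alpha> \<le> M" using supp[of \<alpha>] M by auto
        then show "\<alpha> \<in> int ` {..M}" by blast
      qed
    qed auto
    also have "\<dots> = (\<Sum>i\<le>M. of_real (a (int i)) * z ^ i)"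
      by (subst sum.reindex) (auto simp: inj_on_def)
    also have "\<dots> = poly (cpoly p) z"
      using poly_eq_sum_le[of "cpoly p" M z] degp by (simp add: p)
    finally show ?thesis by simp
  qed
  then have "poly (cpoly p) z = poly (cpoly (q * (\<Prod>j<n. [:1, exp (\<mu> j):]))) z" for z
    by (simp only: poly_cpoly_mult_prod fac)
  then have "cpoly p = cpoly (q * (\<Prod>j<n. [:1, exp (\<mu> j):]))" using poly_eq_poly_eq_iff by blast
  then have "of_real (coeff p i) = (of_real (coeff (q * (\<Prod>j<n. [:1, exp (\<mu> j):])) i) :: complex)" for i
    by (metis coeff_cpoly)
  then have pq: "p = q * (\<Prod>j<n. [:1, exp (\<mu> j):])" by (intro poly_eqI) (simp only: of_real_eq_iff)
  have sf: "spectral_factor n \<mu> q"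
    unfolding spectral_factor_def
  proof (intro conjI allI impI q)
    fix z :: complex assume z: "z \<noteq> 0"
    have "symbol d z + symbol d (- z) = 2" using d z by (simp add: is_interpolatory_symbol_def)
    then have "symbol a z * symbol a (1 / z) + symbol a (- z) * symbol a (1 / - z) = 4"
    proof -
      have "symbol a w * symbol a (1 / w) = 2 * symbol d w" if "w \<noteq> 0" for w using ad[OF that] by simp
      from this[OF z] this[of "- z"] z
      have "symbol a z * symbol a (1 / z) + symbol a (- z) * symbol a (1 / - z) = 2 * (symbol d z + symbol d (- z))"
        by (simp add: distrib_left)
      then show ?thesis using \<open>symbol d z + symbol d (- z) = 2\<close> by simp
    qed
    then show "poly (cpoly q) z * poly (cpoly q) (1 / z) * sym_exp_factor n (\<lambda>j. of_real (exp (\<mu> j))) z +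
        poly (cpoly q) (- z) * poly (cpoly q) (- 1 / z) * sym_exp_factor n (\<lambda>j. of_real (exp (\<mu> j))) (- z) = 4"
      by (simp add: fac sym_exp_factor_def prod.distrib mult_ac)
  qed
  have "q \<noteq> 0" using q(2) by auto
  have "degree (\<Prod>j<n. [:1, exp (\<mu> j):]) = n"
    by (subst degree_prod_eq_sum_degree) auto
  moreover have "(\<Prod>j<n. [:1, exp (\<mu> j):]) \<noteq> 0" by simp
  ultimately have "degree p = M" unfolding pq using \<open>q \<noteq> 0\<close> n q(1) by (subst degree_mult_eq) (auto simp: M_def)
  moreover have "p \<noteq> 0" using \<open>q \<noteq> 0\<close> pq by simp
  ultimately have "a (2 * int n - 1) \<noteq> 0" using p[of M] M by (metis leading_coeff_0_iff)
  moreover have "mask_fps a = fps_of_poly q * (\<Prod>j<n. 1 + fps_const (exp (\<mu> j)) * fps_X)"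
  proof -
    have "mask_fps a = fps_of_poly p" by (rule fps_ext) (simp add: mask_fps_def p)
    also have "\<dots> = fps_of_poly q * (\<Prod>j<n. lin (- exp (\<mu> j)))"
      by (simp add: pq fps_of_poly_mult fps_of_poly_prod fps_of_poly_linear_factor)
    finally show ?thesis by (simp add: lin_def flip: fps_const_neg)
  qed
  moreover have "{\<alpha>. a \<alpha> \<noteq> 0} \<subseteq> {0..2 * int n - 1}" using supp by auto
  ultimately show thesis using that sf by blast
qed

section \<open>Subdivision and wavelets on dyadic grids\<close>

text \<open>One step moves a right end r to \<open>M + 2 * r\<close>; starting from 0 this gives
  \<open>M * (2 ^ J - 1)\<close>.\<close>

lemma subdivide_delta_support:
  assumes A: "\<forall>J. {\<alpha>. A J \<alpha> \<noteq> 0} \<subseteq> {0..M}"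
    and "subdivide A J delta_seq \<alpha> \<noteq> 0"
  shows "0 \<le> \<alpha> \<and> \<alpha> \<le> M * (2 ^ J - 1)"
  using assms(2)
proof (induction J arbitrary: \<alpha>)
  case 0
  then show ?case by (simp add: delta_seq_def split: if_splits)
next
  case (Suc J)
  then have "(\<Sum>\<beta> | A J (\<alpha> - 2 * \<beta>) \<noteq> 0. A J (\<alpha> - 2 * \<beta>) * subdivide A J delta_seq \<beta>) \<noteq> 0"
    by (simp add: subdivision_op_def)
  then obtain \<beta> where \<beta>: "A J (\<alpha> - 2 * \<beta>) \<noteq> 0" "subdivide A J delta_seq \<beta> \<noteq> 0"
    by (rule sum.not_neutral_contains_not_neutral) auto
  have "0 \<le> \<alpha> - 2 * \<beta>" "\<alpha> - 2 * \<beta> \<le> M" using subsetD[OF A[rule_format, of J], of "\<alpha> - 2 * \<beta>"] \<beta>(1) by auto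
  moreover have "0 \<le> \<beta>" "\<beta> \<le> M * (2 ^ J - 1)" using Suc.IH[OF \<beta>(2)] by auto
  moreover have "M * (2 ^ Suc J - 1) = M + 2 * (M * (2 ^ J - 1))" by (simp add: algebra_simps)
  ultimately show ?case by linarith
qed

lemma subdivision_op_fps:
  assumes a: "{\<alpha>. a \<alpha> \<noteq> 0} \<subseteq> {0..M}" and c: "\<And>\<beta>. \<beta> < 0 \<Longrightarrow> c \<beta> = 0"
  shows "mask_fps (subdivision_op a c) = mask_fps a * (mask_fps c oo fps_X ^ 2)"
proof (rule fps_ext)
  fix i
  have "subdivision_op a c (int i) = (\<Sum>\<beta>\<in>int ` {b. 2 * b \<le> i}. a (int i - 2 * \<beta>) * c \<beta>)"
    unfolding subdivision_op_def
  proof (rule sum.mono_neutral_cong)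
    show "finite {\<beta>. a (int i - 2 * \<beta>) \<noteq> 0}"
      by (rule finite_subset[of _ "{- M - int i..int i}"]) (use a in auto)
    have "{b. 2 * b \<le> i} \<subseteq> {..i}" by auto
    then show "finite (int ` {b. 2 * b \<le> i})" using finite_subset by blast
    show "a (int i - 2 * \<beta>) * c \<beta> = 0"
      if "\<beta> \<in> {\<beta>. a (int i - 2 * \<beta>) \<noteq> 0} - int ` {b. 2 * b \<le> i}" for \<beta>
    proof -
      have "\<beta> < 0"
      proof (rule ccontr)
        assume "\<not> \<beta> < 0"
        then have "\<beta> = int (nat \<beta>)" by simp
        moreover have "2 * \<beta> \<le> int i" using subsetD[OF a, of "int i - 2 * \<beta>"] that by auto
        ultimately have "\<beta> \<in> int ` {b. 2 * b \<le> i}" by (intro image_eqI[of _ _ "nat \<beta>"]) auto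
        then show False using that by simp
      qed
      then show ?thesis by (simp add: c)
    qed
  qed auto
  also have "\<dots> = (\<Sum>b | 2 * b \<le> i. c (int b) * a (int (i - 2 * b)))"
    by (subst sum.reindex) (auto simp: inj_on_def of_nat_diff mult.commute intro!: sum.cong)
  also have "\<dots> = (\<Sum>j | j \<le> i \<and> 2 dvd j. c (int (j div 2)) * a (int (i - j)))"
    by (rule sum.reindex_bij_witness[of _ "\<lambda>j. j div 2" "\<lambda>b. 2 * b"]) auto
  also have "\<dots> = ((mask_fps c oo fps_X ^ 2) * mask_fps a) $ i"
    unfolding fps_mult_nth mask_fps_def
    by (rule sum.mono_neutral_cong_left) (auto simp: fps_nth_compose_X_power)
  finally show "mask_fps (subdivision_op a c) $ i = (mask_fps a * (mask_fps c oo fps_X ^ 2)) $ i"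
    by (simp add: mask_fps_def mult.commute)
qed

lemma mask_fps_subdivide:
  assumes A: "\<forall>J. {\<alpha>. A J \<alpha> \<noteq> 0} \<subseteq> {0..M}"
  shows "mask_fps (subdivide A J delta_seq) = cascade (\<lambda>J. mask_fps (A J)) J"
proof (induction J)
  case 0
  show ?case by (rule fps_ext) (simp add: mask_fps_def delta_seq_def)
next
  case (Suc J)
  have "subdivide A J delta_seq \<beta> = 0" if "\<beta> < 0" for \<beta>
    using subdivide_delta_support[OF A, where J = J and \<alpha> = \<beta>] that by force
  then have "mask_fps (subdivide A (Suc J) delta_seq) = mask_fps (A J) * (mask_fps (subdivide A J delta_seq) oo fps_X ^ 2)"
    unfolding subdivide.simps by (intro subdivision_op_fps[OF A[rule_format]]) auto
  then show ?case by (simp add: Suc.IH)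
qed

lemma subdivision_limit_grid:
  assumes "is_subdivision_limit A delta_seq \<phi>" "e > 0"
  shows "\<forall>\<^sub>F J in sequentially. \<forall>\<alpha>. \<bar>\<phi> (of_int \<alpha> / 2 ^ J) - subdivide A J delta_seq \<alpha>\<bar> < e"
  using uniform_limitD[OF conjunct2[OF assms(1)[unfolded is_subdivision_limit_def]] assms(2)]
  by (simp add: dist_real_def)

text \<open>The rounded-down grid points converge to \<open>x\<close>, and their indices lie outside
  the support of the subdivided sequence at every level.\<close>

lemma subdivision_limit_support:
  assumes A: "\<forall>J. {\<alpha>. A J \<alpha> \<noteq> 0} \<subseteq> {0..M}"
    and "M > 0" and lim: "is_subdivision_limit A delta_seq \<phi>" and x: "x \<notin> {0..of_int M}"
  shows "\<phi> x = 0"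
proof (rule LIMSEQ_unique)
  define y where "y J = of_int \<lfloor>x * 2 ^ J\<rfloor> / (2::real) ^ J" for J :: nat
  have y: "y J \<le> x" "x \<le> y J + (1 / 2) ^ J" for J
  proof -
    show "y J \<le> x" by (simp add: y_def divide_le_eq)
    have "x * 2 ^ J \<le> of_int \<lfloor>x * 2 ^ J\<rfloor> + 1" by linarith
    then have "x \<le> (of_int \<lfloor>x * 2 ^ J\<rfloor> + 1) / 2 ^ J" by (simp add: le_divide_eq)
    then show "x \<le> y J + (1 / 2) ^ J" by (simp add: y_def add_divide_distrib power_one_over)
  qed
  have "(\<lambda>J. x - (1 / 2) ^ J) \<longlonglongrightarrow> x - 0" by (intro tendsto_intros LIMSEQ_realpow_zero) auto
  then have "(\<lambda>J. x - (1 / 2) ^ J) \<longlonglongrightarrow> x" by simp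
  from tendsto_sandwich[OF _ _ this tendsto_const] have "y \<longlonglongrightarrow> x"
    using y by (simp add: diff_le_eq)
  moreover have "isCont \<phi> x"
    using lim by (simp add: is_subdivision_limit_def continuous_on_eq_continuous_at)
  ultimately show "(\<lambda>J. \<phi> (y J)) \<longlonglongrightarrow> \<phi> x" by (rule isCont_tendsto_compose[rotated])
  have c0: "subdivide A J delta_seq \<lfloor>x * 2 ^ J\<rfloor> = 0" for J
  proof (rule ccontr)
    assume nz: "subdivide A J delta_seq \<lfloor>x * 2 ^ J\<rfloor> \<noteq> 0"
    then have fl: "0 \<le> \<lfloor>x * 2 ^ J\<rfloor>" "\<lfloor>x * 2 ^ J\<rfloor> \<le> M * (2 ^ J - 1)"
      using subdivide_delta_support[OF A nz] by blast+
    show False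
    proof (cases "x < 0")
      case True
      then have "x * 2 ^ J < 0" by (simp add: mult_neg_pos)
      then show False using fl(1) by linarith
    next
      case False
      then have "x > of_int M" using x by simp
      then have "of_int M * 2 ^ J \<le> x * 2 ^ J" by simp
      then have "M * 2 ^ J \<le> \<lfloor>x * 2 ^ J\<rfloor>" by (simp add: le_floor_iff)
      then show False using fl(2) \<open>M > 0\<close> by (simp add: right_diff_distrib)
    qed
  qed
  show "(\<lambda>J. \<phi> (y J)) \<longlonglongrightarrow> 0"
  proof (rule LIMSEQ_I)
    fix e :: real assume "e > 0"
    obtain N where N: "\<And>J \<alpha>. J \<ge> N \<Longrightarrow> \<bar>\<phi> (of_int \<alpha> / 2 ^ J) - subdivide A J delta_seq \<alpha>\<bar> < e"
      using subdivision_limit_grid[OF lim \<open>e > 0\<close>] by (auto simp: eventually_sequentially)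
    have "\<bar>\<phi> (y J)\<bar> < e" if "J \<ge> N" for J
      using N[OF that, of "\<lfloor>x * 2 ^ J\<rfloor>"] c0[of J] by (simp add: y_def)
    then show "\<exists>N. \<forall>J\<ge>N. norm (\<phi> (y J) - 0) < e" by auto
  qed
qed


text \<open>The generating function of the coefficients of \<open>x \<mapsto> wavelet a \<phi> (x / 2 + 1 - n)\<close> with respect to
  the integer translates of \<open>\<phi>\<close>, for \<open>M = 2 n - 1\<close>.\<close>

definition wavelet_fps :: "nat \<Rightarrow> (int \<Rightarrow> real) \<Rightarrow> real fps" where
  "wavelet_fps M a = Abs_fps (\<lambda>i. (- 1) ^ i * a (int M - int i))"

text \<open>Substitution \<alpha> = i - 2 (n - 1): the smallest possible index becomes 0, and the
  even shift leaves the signs unchanged.\<close>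

lemma wavelet_eq_sum:
  assumes "n \<ge> 1" and a: "{\<alpha>. a \<alpha> \<noteq> 0} \<subseteq> {0..2 * int n - 1}"
  shows "wavelet a \<phi> x = (\<Sum>i\<le>2 * n - 1. wavelet_fps (2 * n - 1) a $ i * \<phi> (2 * x + 2 * (real n - 1) - real i))"
proof -
  have M: "int (2 * n - 1) = 2 * int n - 1" using assms(1) by simp
  have "wavelet a \<phi> x = (\<Sum>\<alpha>\<in>(\<lambda>i. int i - 2 * int (n - 1)) ` {..2 * n - 1}.
      (- 1) powi \<alpha> * a (1 - \<alpha>) * \<phi> (2 * x - of_int \<alpha>))"
    unfolding wavelet_def
  proof (rule sum.mono_neutral_left)
    show "{\<alpha>. a (1 - \<alpha>) \<noteq> 0} \<subseteq> (\<lambda>i. int i - 2 * int (n - 1)) ` {..2 * n - 1}"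
    proof
      fix \<alpha> assume "\<alpha> \<in> {\<alpha>. a (1 - \<alpha>) \<noteq> 0}"
      then have "0 \<le> 1 - \<alpha>" "1 - \<alpha> \<le> 2 * int n - 1" using subsetD[OF a, of "1 - \<alpha>"] by auto
      then show "\<alpha> \<in> (\<lambda>i. int i - 2 * int (n - 1)) ` {..2 * n - 1}"
        using assms(1) by (intro image_eqI[of _ _ "nat (\<alpha> + 2 * int (n - 1))"]) auto
    qed
  qed auto
  also have "\<dots> = (\<Sum>i\<le>2 * n - 1. (- 1) powi (int i - 2 * int (n - 1)) * a (1 - (int i - 2 * int (n - 1))) *
      \<phi> (2 * x - of_int (int i - 2 * int (n - 1))))"
    by (subst sum.reindex) (auto simp: inj_on_def)
  also have "\<dots> = (\<Sum>i\<le>2 * n - 1. wavelet_fps (2 * n - 1) a $ i * \<phi> (2 * x + 2 * (real n - 1) - real i))"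
  proof (rule sum.cong)
    fix i
    have "(- 1 :: real) powi (int i - 2 * int (n - 1)) = (- 1) ^ i"
      by (simp add: power_int_diff power_int_mult)
    moreover have "1 - (int i - 2 * int (n - 1)) = int (2 * n - 1) - int i" using assms(1) by (simp add: of_nat_diff)
    moreover have "2 * x - of_int (int i - 2 * int (n - 1)) = 2 * x + 2 * (real n - 1) - real i"
      using assms(1) by (simp add: of_nat_diff)
    ultimately show "(- 1) powi (int i - 2 * int (n - 1)) * a (1 - (int i - 2 * int (n - 1))) *
        \<phi> (2 * x - of_int (int i - 2 * int (n - 1))) =
        wavelet_fps (2 * n - 1) a $ i * \<phi> (2 * x + 2 * (real n - 1) - real i)"
      by (simp only: wavelet_fps_def fps_nth_Abs_fps)
  qed simp
  finally show ?thesis .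
qed

lemma wavelet_support:
  assumes "n \<ge> 1" and a: "{\<alpha>. a \<alpha> \<noteq> 0} \<subseteq> {0..2 * int n - 1}"
    and \<phi>: "\<And>x. x \<notin> {0..2 * real n - 1} \<Longrightarrow> \<phi> x = 0" and x: "x \<notin> {1 - real n..real n}"
  shows "wavelet a \<phi> x = 0"
  unfolding wavelet_eq_sum[OF assms(1,2)]
proof (intro sum.neutral ballI)
  fix i assume "i \<in> {..2 * n - 1}"
  then have "real i \<le> 2 * real n - 1" using assms(1) by (simp add: of_nat_diff le_diff_conv2 flip: of_nat_le_iff)
  then have "2 * x + 2 * (real n - 1) - real i \<notin> {0..2 * real n - 1}" using x by auto
  then show "wavelet_fps (2 * n - 1) a $ i * \<phi> (2 * x + 2 * (real n - 1) - real i) = 0" by (simp add: \<phi>)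
qed

lemma wavelet_continuous:
  assumes "n \<ge> 1" "{\<alpha>. a \<alpha> \<noteq> 0} \<subseteq> {0..2 * int n - 1}" "continuous_on UNIV \<phi>"
  shows "continuous_on UNIV (wavelet a \<phi>)"
proof -
  have "continuous_on UNIV (\<lambda>x. \<phi> (2 * x + 2 * (real n - 1) - real i))" for i :: nat
    by (rule continuous_on_compose2[OF assms(3)]) (auto intro!: continuous_intros)
  then show ?thesis
    unfolding wavelet_eq_sum[OF assms(1,2), abs_def] by (intro continuous_intros)
qed

text \<open>At 1 - n + \<alpha> / 2^(J+1) the i-th translate of \<phi> is evaluated at the grid
  point (\<alpha> - i 2^J) / 2^J. A shift by i 2^J is multiplication by y^(i 2^J), hence the dilated
  \<open>wavelet_fps\<close>.\<close>

lemma wavelet_grid: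
  assumes n: "n \<ge> 1" and a: "{\<alpha>. a \<alpha> \<noteq> 0} \<subseteq> {0..2 * int n - 1}"
    and A: "\<forall>J. {\<alpha>. A J \<alpha> \<noteq> 0} \<subseteq> {0..M}"
    and lim: "is_subdivision_limit A delta_seq \<phi>" and "e > 0"
  shows "\<forall>\<^sub>F J in sequentially. \<forall>\<alpha>. \<bar>wavelet a \<phi> ((1 - real n) + 1 / 2 * real \<alpha> / 2 ^ J) -
    ((wavelet_fps (2 * n - 1) a oo fps_X ^ (2 ^ J)) * cascade (\<lambda>J. mask_fps (A J)) J) $ \<alpha>\<bar> < e"
proof -
  let ?b = "\<lambda>i. wavelet_fps (2 * n - 1) a $ i"
  define K where "K = (\<Sum>i\<le>2 * n - 1. \<bar>?b i\<bar>) + 1"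
  have "K > 0" unfolding K_def by (intro add_nonneg_pos sum_nonneg) auto
  have b0: "?b i = 0" if "i > 2 * n - 1" for i
    using subsetD[OF a, of "int (2 * n - 1) - int i"] that by (auto simp: wavelet_fps_def)
  have "\<forall>\<^sub>F J in sequentially. \<forall>\<alpha>. \<bar>\<phi> (of_int \<alpha> / 2 ^ J) - subdivide A J delta_seq \<alpha>\<bar> < e / K"
    using \<open>e > 0\<close> \<open>K > 0\<close> by (intro subdivision_limit_grid[OF lim]) simp
  then show ?thesis
  proof (rule eventually_mono, intro allI)
    fix J \<alpha> assume *: "\<forall>\<alpha>. \<bar>\<phi> (of_int \<alpha> / 2 ^ J) - subdivide A J delta_seq \<alpha>\<bar> < e / K"
    let ?c = "subdivide A J delta_seq"
    have "((wavelet_fps (2 * n - 1) a oo fps_X ^ (2 ^ J)) * cascade (\<lambda>J. mask_fps (A J)) J) $ \<alpha> =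
        (\<Sum>j\<le>\<alpha>. (if 2 ^ J dvd j then ?b (j div 2 ^ J) else 0) * ?c (int (\<alpha> - j)))"
      unfolding fps_mult_nth mask_fps_subdivide[OF A, symmetric] atLeast0AtMost
      by (intro sum.cong) (auto simp: fps_nth_compose_X_power mask_fps_def)
    also have "\<dots> = (\<Sum>j | j \<le> \<alpha> \<and> 2 ^ J dvd j. ?b (j div 2 ^ J) * ?c (int \<alpha> - int j))"
      by (rule sum.mono_neutral_cong_right) (auto simp: of_nat_diff)
    also have "\<dots> = (\<Sum>i | i * 2 ^ J \<le> \<alpha>. ?b i * ?c (int \<alpha> - int (i * 2 ^ J)))"
      by (rule sum.reindex_bij_witness[of _ "\<lambda>i. i * 2 ^ J" "\<lambda>j. j div 2 ^ J"])
        (auto simp del: of_nat_mult of_nat_power)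
    also have "\<dots> = (\<Sum>i\<le>2 * n - 1. ?b i * ?c (int \<alpha> - int i * 2 ^ J))"
    proof (rule sum.mono_neutral_cong)
      have "{i. i * 2 ^ J \<le> \<alpha>} \<subseteq> {..\<alpha>}" by (auto intro: order_trans[rotated])
      then show "finite {i. i * 2 ^ J \<le> \<alpha>}" using finite_subset by blast
      show "?b i * ?c (int \<alpha> - int i * 2 ^ J) = 0" if "i \<in> {..2 * n - 1} - {i. i * 2 ^ J \<le> \<alpha>}" for i
      proof -
        have "\<alpha> < i * 2 ^ J" using that by auto
        then have "int \<alpha> < int (i * 2 ^ J)" by (simp only: of_nat_less_iff)
        then have "\<not> 0 \<le> int \<alpha> - int i * 2 ^ J" by simp
        then have "?c (int \<alpha> - int i * 2 ^ J) = 0" using subdivide_delta_support[OF A] by blast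
        then show ?thesis by simp
      qed
    qed (use b0 in auto)
    finally have "wavelet a \<phi> ((1 - real n) + 1 / 2 * real \<alpha> / 2 ^ J) -
        ((wavelet_fps (2 * n - 1) a oo fps_X ^ (2 ^ J)) * cascade (\<lambda>J. mask_fps (A J)) J) $ \<alpha> =
        (\<Sum>i\<le>2 * n - 1. ?b i * (\<phi> (of_int (int \<alpha> - int i * 2 ^ J) / 2 ^ J) - ?c (int \<alpha> - int i * 2 ^ J)))"
      by (simp add: wavelet_eq_sum[OF n a] right_diff_distrib sum_subtractf diff_divide_distrib distrib_left)
    also have "\<bar>\<dots>\<bar> \<le> (\<Sum>i\<le>2 * n - 1. \<bar>?b i\<bar> * (e / K))"
      by (rule order_trans[OF sum_abs], rule sum_mono, simp only: abs_mult)
        (intro mult_left_mono less_imp_le *[rule_format] abs_ge_zero)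
    also have "\<dots> < K * (e / K)"
      using \<open>e > 0\<close> \<open>K > 0\<close> by (simp only: sum_distrib_right[symmetric]) (intro mult_strict_right_mono, auto simp: K_def)
    also have "\<dots> = e" using \<open>K > 0\<close> by simp
    finally show "\<bar>wavelet a \<phi> ((1 - real n) + 1 / 2 * real \<alpha> / 2 ^ J) -
        ((wavelet_fps (2 * n - 1) a oo fps_X ^ (2 ^ J)) * cascade (\<lambda>J. mask_fps (A J)) J) $ \<alpha>\<bar> < e" .
  qed
qed


theorem theorem5:
  fixes n :: nat
    and \<Lambda> :: "nat \<Rightarrow> real"
    and a :: "nat \<Rightarrow> int \<Rightarrow> real"
    and m :: "int \<Rightarrow> real"
    and \<phi> :: "nat \<Rightarrow> real \<Rightarrow> real"
    and \<phi>\<^sub>n :: "real \<Rightarrow> real"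
  assumes "n \<ge> 2"
    and "\<And>k. k \<ge> 1 \<Longrightarrow> is_generalized_daubechies_mask n \<Lambda> k (a k)"
    and "\<And>k. k \<ge> 1 \<Longrightarrow> is_subdivision_limit (\<lambda>j. a (k + j)) delta_seq (\<phi> k)"
    and "is_classical_daubechies_mask n m"
    and "is_subdivision_limit (\<lambda>_. m) delta_seq \<phi>\<^sub>n"
  shows "hoelder_regularity (wavelet (a 1) (\<phi> 2)) = hoelder_regularity (wavelet m \<phi>\<^sub>n)"
proof -
  have n: "n \<ge> 1" using assms(1) by simp
  have mask: "is_daubechies_mask n (\<lambda>j. \<Lambda> j / 2 ^ k) (a k)" if "k \<ge> 1" for k
    using assms(2)[OF that] by (simp add: is_generalized_daubechies_mask_def)
  obtain q where q: "spectral_factor n (\<lambda>_. 0) q"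
      "mask_fps m = fps_of_poly q * (\<Prod>j<n. 1 + fps_const (exp 0) * fps_X)"
      "m (2 * int n - 1) \<noteq> 0" "{\<alpha>. m \<alpha> \<noteq> 0} \<subseteq> {0..2 * int n - 1}"
    using daubechies_mask_factorization[OF n assms(4)[unfolded is_classical_daubechies_mask_def]] by blast
  have "\<exists>r. spectral_factor n (\<lambda>j. \<Lambda> j / 2 ^ k) r \<and>
      mask_fps (a k) = fps_of_poly r * (\<Prod>j<n. 1 + fps_const (exp (\<Lambda> j / 2 ^ k)) * fps_X)" if "k \<ge> 1" for k
    using daubechies_mask_factorization[OF n mask[OF that]] by metis
  then obtain Q where Q: "\<And>k. k \<ge> 1 \<Longrightarrow> spectral_factor n (\<lambda>j. \<Lambda> j / 2 ^ k) (Q k)"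
      "\<And>k. k \<ge> 1 \<Longrightarrow> mask_fps (a k) = fps_of_poly (Q k) * (\<Prod>j<n. 1 + fps_const (exp (\<Lambda> j / 2 ^ k)) * fps_X)"
    by metis
  have a1: "a 1 (2 * int n - 1) \<noteq> 0" using daubechies_mask_factorization[OF n mask[of 1]] by auto
  have supp: "{\<alpha>. a k \<alpha> \<noteq> 0} \<subseteq> {0..2 * int n - 1}" if "k \<ge> 1" for k
    using daubechies_mask_factorization[OF n mask[OF that]] by blast
  \<comment> \<open>The refinement of \<open>\<phi> 2\<close> starts with the mask of level 2. Hence
    the frequencies enter as \<Lambda> / 4 in the spectral factors, indexed by 2^J, and as \<Lambda>
    / 2 in \<open>exp_factor\<close>, which divides by 2^(J+1).\<close>
  define P where "P J = Q (2 + J)" for J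
  have P: "spectral_factor n (\<lambda>j. \<Lambda> j / 4 / 2 ^ J) (P J)" for J
    using Q(1)[of "2 + J"] by (simp add: P_def power_add mult.commute)
  obtain \<epsilon> I where eps: "summable \<epsilon>" "\<And>k. \<epsilon> k \<ge> 0"
    and near: "\<And>N k. k \<ge> I \<Longrightarrow> l1_upto N (fps_of_poly (P k) * inverse (fps_of_poly q)) \<le> 1 + \<epsilon> k"
      "\<And>N k. k \<ge> I \<Longrightarrow> l1_upto N (fps_of_poly q * inverse (fps_of_poly (P k))) \<le> 1 + \<epsilon> k"
    using spectral_factor_ratios_near_1[OF n q(1) P] by metis
  have nz: "fps_of_poly r $ 0 \<noteq> 0" if "spectral_factor n \<mu> r" for \<mu> r
  proof -
    have "poly (cpoly r) 0 \<noteq> 0" using that by (force simp: spectral_factor_def)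
    then show ?thesis by (simp add: poly_0_coeff_0)
  qed
  let ?B = "wavelet_fps (2 * n - 1)"
  let ?C = "cascade (\<lambda>J. mask_fps (a (2 + J)))" and ?M = "cascade (\<lambda>J. mask_fps m)"
  let ?\<psi> = "wavelet (a 1) (\<phi> 2)" and ?\<psi>n = "wavelet m \<phi>\<^sub>n"
  have Bnz: "?B (a 1) $ 0 \<noteq> 0" "?B m $ 0 \<noteq> 0"
    using a1 q(3) n by (simp_all add: wavelet_fps_def of_nat_diff)
  have Afac: "(\<lambda>J. mask_fps (a (2 + J))) = (\<lambda>J. fps_of_poly (P J) * (\<Prod>j<n. exp_factor (\<Lambda> j / 2) J))"
    using Q(2)[of "2 + _"] by (simp add: P_def exp_factor_def fun_eq_iff mult.assoc)
  have Mfac: "(\<lambda>J. mask_fps m) = (\<lambda>J. fps_of_poly q * (\<Prod>j<n. exp_factor 0 J))"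
    using q(2) by (simp add: exp_factor_def)
  obtain R where R: "\<And>J. (?B (a 1) oo fps_X ^ (2 ^ J)) * ?C J = R J * ((?B m oo fps_X ^ (2 ^ J)) * ?M J)"
      "\<And>X. \<exists>K. \<forall>J. l1_upto (X * 2 ^ J) (R J) \<le> K"
    using cascade_ratio[where B = "?B (a 1)" and B' = "?B m" and Q = "\<lambda>J. fps_of_poly (P J)" and Q' = "\<lambda>J. fps_of_poly q"
        and s = "\<lambda>j. \<Lambda> j / 2" and t = "\<lambda>_. 0" and n = n, OF nz[OF q(1)] Bnz(2) eps near(1)]
    unfolding Afac Mfac by blast
  obtain R' where R': "\<And>J. (?B m oo fps_X ^ (2 ^ J)) * ?M J = R' J * ((?B (a 1) oo fps_X ^ (2 ^ J)) * ?C J)"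
      "\<And>X. \<exists>K. \<forall>J. l1_upto (X * 2 ^ J) (R' J) \<le> K"
    using cascade_ratio[where B = "?B m" and B' = "?B (a 1)" and Q = "\<lambda>J. fps_of_poly q" and Q' = "\<lambda>J. fps_of_poly (P J)"
        and s = "\<lambda>_. 0" and t = "\<lambda>j. \<Lambda> j / 2" and n = n, OF nz[OF P] Bnz(1) eps near(2)]
    unfolding Afac Mfac by blast
  have lim: "is_subdivision_limit (\<lambda>J. a (2 + J)) delta_seq (\<phi> 2)" using assms(3)[of 2] by simp
  have suppA: "\<forall>J. {\<alpha>. a (2 + J) \<alpha> \<noteq> 0} \<subseteq> {0..2 * int n - 1}" using supp by simp
  have suppM: "\<forall>J::nat. {\<alpha>. m \<alpha> \<noteq> 0} \<subseteq> {0..2 * int n - 1}" using q(4) by simp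
  have pos: "0 < 2 * int n - 1" using n by simp
  have \<phi>supp: "\<phi> 2 x = 0" if "x \<notin> {0..2 * real n - 1}" for x
    using subdivision_limit_support[OF suppA pos lim, of x] that by simp
  have \<phi>nsupp: "\<phi>\<^sub>n x = 0" if "x \<notin> {0..2 * real n - 1}" for x
    using subdivision_limit_support[OF suppM pos assms(5), of x] that by simp
  note supp1 = supp[of 1, simplified]
  have cont: "continuous_on UNIV ?\<psi>" "continuous_on UNIV ?\<psi>n"
    using wavelet_continuous[OF n supp1] wavelet_continuous[OF n q(4)] lim assms(5)
    by (simp_all add: is_subdivision_limit_def)
  have vanish: "?\<psi> x = 0" "?\<psi>n x = 0" if "x \<notin> {1 - real n..real n}" for x
    using wavelet_support[OF n supp1 \<phi>supp that] wavelet_support[OF n q(4) \<phi>nsupp that] by auto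
  \<comment> \<open>The mesh factor 1/2 comes from the argument 2 x in
    \<open>wavelet\<close>.\<close>
  interpret fwd: grid_transfer ?\<psi>n ?\<psi> "\<lambda>J. (?B m oo fps_X ^ (2 ^ J)) * ?M J"
    "\<lambda>J. (?B (a 1) oo fps_X ^ (2 ^ J)) * ?C J" R "1 - real n" "real n" "1 / 2"
    by unfold_locales
      (use cont vanish R wavelet_grid[OF n q(4) suppM assms(5)] wavelet_grid[OF n supp1 suppA lim] in
        \<open>simp_all add: l1_upto_def\<close>)
  interpret bwd: grid_transfer ?\<psi> ?\<psi>n "\<lambda>J. (?B (a 1) oo fps_X ^ (2 ^ J)) * ?C J"
    "\<lambda>J. (?B m oo fps_X ^ (2 ^ J)) * ?M J" R' "1 - real n" "real n" "1 / 2"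
    by unfold_locales
      (use cont vanish R' wavelet_grid[OF n q(4) suppM assms(5)] wavelet_grid[OF n supp1 suppA lim] in
        \<open>simp_all add: l1_upto_def\<close>)
  show ?thesis
  proof (rule hoelder_regularity_eqI[OF _ cont(1)])
    show "C_on_reals r ?\<psi> \<longleftrightarrow> C_on_reals r ?\<psi>n" for r
      using fwd.C_on_reals_transfer bwd.C_on_reals_transfer by blast
    fix r :: nat and \<nu> :: real assume "C_on_reals r ?\<psi>" "C_on_reals r ?\<psi>n" "0 \<le> \<nu>"
    then show "(\<exists>c. \<forall>x y. \<bar>(deriv ^^ r) ?\<psi> x - (deriv ^^ r) ?\<psi> y\<bar> \<le> c * \<bar>x - y\<bar> powr \<nu>) \<longleftrightarrow>
        (\<exists>c. \<forall>x y. \<bar>(deriv ^^ r) ?\<psi>n x - (deriv ^^ r) ?\<psi>n y\<bar> \<le> c * \<bar>x - y\<bar> powr \<nu>)"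
      using fwd.hoelder_transfer[of r \<nu>] bwd.hoelder_transfer[of r \<nu>] by blast
  qed
qed

end
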